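(* For every $\lambda\in\mathbb{C}$, the Fatou set of the meromorphic map $f_\lambda(z)=\lambda+\tan(z^2)$ has no Herman ring.
   Context: For a transcendental meromorphic map $f:\mathbb{C}\to\hat{\mathbb{C}}$, the Fatou set is the set of points $z$ having a neighborhood on which all iterates $f^{\circ n}$ are defined and form a normal family. A Fatou component is a connected component of the Fatou set. A periodic cycle of Fatou components $S_0,\dots,S_{p-1}$ is a cycle of Herman rings if each $S_i$ is holomorphically homeomorphic to a standard round annulus and the first return map $f^{\circ p}:S_i\to S_i$ is conjugate, by a holomorphic homeomorphism, to an irrational rotation of that annulus. *)

theory Defs
  imports "HOL-Complex_Analysis.Complex_Analysis"
begin

datatype riemann_sphere = Finite complex | Infinity

fun stereographic :: "riemann_sphere \<Rightarrow> complex \<times> real" where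
  "stereographic (Finite z) =
     (complex_of_real (2 / ((cmod z)\<^sup>2 + 1)) * z, ((cmod z)\<^sup>2 - 1) / ((cmod z)\<^sup>2 + 1))"
| "stereographic Infinity = (0, 1)"

lemma stereographic_height: "((cmod z)\<^sup>2 - 1) / ((cmod z)\<^sup>2 + 1) = 1 - 2 / ((cmod z)\<^sup>2 + 1)"
proof -
  have "(cmod z)\<^sup>2 + 1 > 0"
    by (simp add: add_nonneg_pos)
  then show ?thesis
    by (simp add: field_simps)
qed

lemma stereographic_inject: "stereographic P = stereographic Q \<longleftrightarrow> P = Q"
proof
  have pos: "(cmod z)\<^sup>2 + 1 > 0" for z
    by (simp add: add_nonneg_pos)
  assume eq: "stereographic P = stereographic Q"
  show "P = Q"
  proof (cases P)
    case P: (Finite z)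
    show ?thesis
    proof (cases Q)
      case Q: (Finite w)
      have "2 / ((cmod z)\<^sup>2 + 1) = 2 / ((cmod w)\<^sup>2 + 1)"
        using eq unfolding P Q stereographic.simps stereographic_height by simp
      moreover have "2 / ((cmod w)\<^sup>2 + 1) \<noteq> 0"
        using pos[of w] by simp
      ultimately have "z = w"
        using eq unfolding P Q stereographic.simps prod.inject
        by (metis mult_cancel_left of_real_eq_0_iff)
      then show ?thesis
        using P Q by simp
    next
      case Q: Infinity
      have "2 / ((cmod z)\<^sup>2 + 1) = 0"
        using eq unfolding P Q stereographic.simps stereographic_height by simp
      then show ?thesis
        using pos[of z] by simp
    qed
  next
    case P: Infinity
    show ?thesis
    proof (cases Q)
      case Q: (Finite w)
      have "2 / ((cmod w)\<^sup>2 + 1) = 0"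
        using eq unfolding P Q stereographic.simps stereographic_height by simp
      then show ?thesis
        using pos[of w] by simp
    next
      case Infinity
      then show ?thesis
        using P by simp
    qed
  qed
qed simp

text \<open>The sphere carries the chordal metric, so limits and uniform convergence of sphere-valued
  maps are those of the spherical metric; in particular, convergence to infinity is allowed.\<close>

instantiation riemann_sphere :: metric_space
begin

definition dist_riemann_sphere :: "riemann_sphere \<Rightarrow> riemann_sphere \<Rightarrow> real" where
  "dist_riemann_sphere P Q = dist (stereographic P) (stereographic Q)"

definition uniformity_riemann_sphere :: "(riemann_sphere \<times> riemann_sphere) filter" where
  "uniformity_riemann_sphere = (INF e\<in>{0<..}. principal {(P, Q). dist P Q < e})"

definition open_riemann_sphere :: "riemann_sphere set \<Rightarrow> bool" where
  "open_riemann_sphere U \<longleftrightarrow>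
     (\<forall>P\<in>U. eventually (\<lambda>(P', Q). P' = P \<longrightarrow> Q \<in> U) uniformity)"

instance
proof
  fix P Q R :: riemann_sphere
  show "dist P Q = 0 \<longleftrightarrow> P = Q"
    by (simp add: dist_riemann_sphere_def stereographic_inject)
  show "dist P Q \<le> dist P R + dist Q R"
    by (simp add: dist_riemann_sphere_def dist_triangle2)
qed (simp_all add: uniformity_riemann_sphere_def open_riemann_sphere_def)

end

text \<open>The \<open>n\<close>-th iterate of a map from the plane to the sphere is defined at \<open>z\<close> only if none of the
  earlier iterates has the value infinity there. Where it is undefined, \<open>iterate f n z\<close> has the
  arbitrary value infinity, so \<open>iterate_defined\<close> has to be required separately.\<close>

primrec iterate :: "(complex \<Rightarrow> riemann_sphere) \<Rightarrow> nat \<Rightarrow> complex \<Rightarrow> riemann_sphere" where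
  "iterate f 0 z = Finite z"
| "iterate f (Suc n) z = (case iterate f n z of Finite w \<Rightarrow> f w | Infinity \<Rightarrow> Infinity)"

definition iterate_defined :: "(complex \<Rightarrow> riemann_sphere) \<Rightarrow> nat \<Rightarrow> complex \<Rightarrow> bool" where
  "iterate_defined f n z \<longleftrightarrow> (\<forall>k<n. iterate f k z \<noteq> Infinity)"

definition normal_family :: "complex set \<Rightarrow> (complex \<Rightarrow> riemann_sphere) set \<Rightarrow> bool" where
  "normal_family U \<F> \<longleftrightarrow>
     (\<forall>s :: nat \<Rightarrow> complex \<Rightarrow> riemann_sphere. range s \<subseteq> \<F> \<longrightarrow>
        (\<exists>r g. strict_mono r \<and>
           (\<forall>K. compact K \<and> K \<subseteq> U \<longrightarrow> uniform_limit K (\<lambda>n. s (r n)) g sequentially)))"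

definition fatou_set :: "(complex \<Rightarrow> riemann_sphere) \<Rightarrow> complex set" where
  "fatou_set f = {z. \<exists>U. open U \<and> z \<in> U \<and> (\<forall>n. \<forall>w\<in>U. iterate_defined f n w) \<and>
     normal_family U (range (iterate f))}"

definition fatou_component :: "(complex \<Rightarrow> riemann_sphere) \<Rightarrow> complex set \<Rightarrow> bool" where
  "fatou_component f U \<longleftrightarrow> U \<in> components (fatou_set f)"

text \<open>Distinctness of the components makes \<open>p\<close> the exact period, so that the \<open>p\<close>-th iterate is the
  first return map.\<close>

definition fatou_cycle :: "(complex \<Rightarrow> riemann_sphere) \<Rightarrow> nat \<Rightarrow> (nat \<Rightarrow> complex set) \<Rightarrow> bool" where
  "fatou_cycle f p S \<longleftrightarrow> p > 0 \<and> inj_on S {..<p} \<and>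
     (\<forall>i<p. fatou_component f (S i) \<and> f ` S i \<subseteq> Finite ` S (Suc i mod p))"

definition round_annulus :: "real \<Rightarrow> real \<Rightarrow> complex set" where
  "round_annulus a b = {z. a < cmod z \<and> cmod z < b}"

definition conjugate_to_irrational_rotation ::
    "(complex \<Rightarrow> riemann_sphere) \<Rightarrow> complex set \<Rightarrow> bool" where
  "conjugate_to_irrational_rotation h U \<longleftrightarrow>
     (\<exists>a b \<phi> \<psi> \<theta>. 0 < a \<and> a < b \<and>
        homeomorphism U (round_annulus a b) \<phi> \<psi> \<and> \<phi> holomorphic_on U \<and> \<theta> \<notin> \<rat> \<and>
        (\<forall>z\<in>U. \<exists>w\<in>U. h z = Finite w \<and> \<phi> w = cis (2 * pi * \<theta>) * \<phi> z))"

definition herman_ring_cycle ::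
    "(complex \<Rightarrow> riemann_sphere) \<Rightarrow> nat \<Rightarrow> (nat \<Rightarrow> complex set) \<Rightarrow> bool" where
  "herman_ring_cycle f p S \<longleftrightarrow> fatou_cycle f p S \<and>
     (\<forall>i<p. conjugate_to_irrational_rotation (iterate f p) (S i))"

definition herman_ring :: "(complex \<Rightarrow> riemann_sphere) \<Rightarrow> complex set \<Rightarrow> bool" where
  "herman_ring f U \<longleftrightarrow> (\<exists>p S. herman_ring_cycle f p S \<and> U \<in> S ` {..<p})"

text \<open>The poles have to be treated separately, since \<^term>\<open>tan w\<close> is \<open>0\<close> where
  \<^term>\<open>cos w\<close> vanishes.\<close>

definition tan_square_map :: "complex \<Rightarrow> complex \<Rightarrow> riemann_sphere" where
  "tan_square_map c z = (if cos (z\<^sup>2) = 0 then Infinity else Finite (c + tan (z\<^sup>2)))"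

end

theory Submission
  imports Defs
begin

text \<open>Why there is no Herman ring.  Write \<open>F z = c + tan (z\<^sup>2)\<close>.  Choose an invariant curve in one
  ring of the cycle; its forward images are invariant Jordan curves \<open>G i\<close>, one in each ring, with interiors
  \<open>D i\<close>.

  \<^bold>\<open>Univalence.\<close>  \<open>F\<close> is injective on a ring, because the return map is.  Since \<open>F\<close> is even, the
  curve \<open>G i\<close> is disjoint from its reflection \<open>- G i\<close>, and these two congruent Jordan curves cannot
  be nested; so \<open>D i\<close> is disjoint from \<open>- D i\<close>.  In the same way the squared curve and its interior are
  disjoint from their translates by nonzero multiples of \<open>pi\<close>.  Hence \<open>F\<close> is injective on the closure of \<open>D i\<close>
  and has at most one pole there (\<open>filled_squares_incongruent\<close>).

  \<^bold>\<open>The omitted value.\<close>  \<open>F\<close> omits \<open>v = c + \<i>\<close>.  If \<open>D i\<close> contains no pole, \<open>F\<close> maps it onto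
  \<open>D (i + 1)\<close>, which then does not contain \<open>v\<close>.  If it contains a pole, \<open>F\<close> maps it onto the exterior of
  \<open>G (i + 1)\<close>, including infinity, and \<open>v\<close> lies in \<open>D (i + 1)\<close>.  Some \<open>D i\<close> must contain a pole, as
  otherwise the iterates would be normal on the discs, holes of the rings included.  The discs
  that contain \<open>v\<close> are nested; let \<open>D m\<close> be the outermost one, and let \<open>R\<close> be the iterate of \<open>F\<close>
  that leads from \<open>D m\<close> through its first pole.  Then \<open>R\<close> is a conformal map of \<open>D m\<close> onto the complement in the
  sphere of a closed disc \<open>Q\<^sub>1\<close>, bounded by one of the curves, and \<open>Q\<^sub>1\<close> lies in \<open>D m\<close> because its
  interior contains \<open>v\<close>.  It is not \<open>D m\<close> itself, because a rotation preserves the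
  sides of its invariant curves.

  \<^bold>\<open>The dynamics of \<open>R\<close>.\<close>  Let \<open>Q\<^sub>2 = R Q\<^sub>1\<close>, \<open>Q\<^sub>3 = R Q\<^sub>2\<close>, and so on, as long as these discs stay in
  \<open>D m\<close>.  They are pairwise disjoint.  The sequence must stop, since by
  periodicity \<open>Q\<^sub>1\<close> would recur although it is not in the image of \<open>R\<close>.  Let \<open>Y\<close> be \<open>D m\<close>
  without these discs.  There are two ways to stop.

  \<^item> The last disc contains the pole of \<open>R\<close>.  Then \<open>R\<close> maps \<open>Y\<close> into itself, so the connected set \<open>Y\<close>
  lies in the Fatou set; but it meets two different rings (\<open>pole_not_in_last\<close>).
  \<^item> The image of the last disc lies outside \<open>D m\<close>.  Then the inverse \<open>h\<close> of \<open>R\<close> maps \<open>Y\<close> into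
  itself.  The successive preimages \<open>h\<^sup>n (G m)\<close> are pairwise disjoint, so by the theorems of Montel and
  Hurwitz some of them are arbitrarily small (\<open>preimages_shrink\<close>).  A small one encloses none of the
  discs \<open>Q\<^sub>i\<close>.  Applying \<open>R\<close> preserves this property (\<open>pullback_step\<close>), so \<open>G m\<close> would enclose none of
  them either, which is absurd.\<close>

section \<open>Plane Jordan curves as sets\<close>

definition jordan_curve :: "complex set \<Rightarrow> bool" where
  "jordan_curve G \<longleftrightarrow> (\<exists>c. simple_path c \<and> pathfinish c = pathstart c \<and> path_image c = G)"

definition filled :: "complex set \<Rightarrow> complex set" where
  "filled G = inside G \<union> G"

lemma jordan_curveD:
  assumes "jordan_curve G"
  shows "compact G" "connected G" "G \<noteq> {}" "inside G \<noteq> {}" "open (inside G)" "connected (inside G)"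
    "bounded (inside G)" "outside G \<noteq> {}" "open (outside G)" "connected (outside G)"
    "\<not> bounded (outside G)" "inside G \<inter> outside G = {}" "inside G \<union> outside G = - G"
    "closure (inside G) = filled G" "closure (outside G) = outside G \<union> G"
proof -
  obtain c where c: "simple_path c" "pathfinish c = pathstart c" "path_image c = G"
    using assms unfolding jordan_curve_def by blast
  note J = Jordan_inside_outside[OF c(1,2), unfolded c(3)]
  show "compact G" "connected G" "G \<noteq> {}"
    using c compact_simple_path_image connected_simple_path_image path_image_nonempty by metis+
  show "inside G \<noteq> {}" "open (inside G)" "connected (inside G)"
    "bounded (inside G)" "outside G \<noteq> {}" "open (outside G)" "connected (outside G)"
    "\<not> bounded (outside G)" "inside G \<inter> outside G = {}" "inside G \<union> outside G = - G"
    using J by auto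
  show "closure (inside G) = filled G" "closure (outside G) = outside G \<union> G"
    using J closure_Un_frontier[of "inside G"] closure_Un_frontier[of "outside G"]
    unfolding filled_def by auto
qed

lemma filled_compl_outside: "filled G = - outside G"
  unfolding filled_def using inside_Un_outside[of G] inside_Int_outside[of G] outside_no_overlap[of G]
  by blast

lemma filled_props:
  assumes "jordan_curve G"
  shows "compact (filled G)" "connected (filled G)" "connected (- filled G)"
    "inside G \<subseteq> filled G" "G \<subseteq> filled G" "filled G - G = inside G"
proof -
  note J = jordan_curveD[OF assms]
  show "compact (filled G)" using J(7,14) by (metis compact_closure)
  show "connected (filled G)" using J(6,14) by (metis connected_imp_connected_closure)
  show "connected (- filled G)" using J(10) by (simp add: filled_compl_outside)
  show "inside G \<subseteq> filled G" "G \<subseteq> filled G" "filled G - G = inside G"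
    unfolding filled_def using inside_no_overlap[of G] by blast+
qed

lemma jordan_curve_image:
  fixes f :: "complex \<Rightarrow> complex"
  assumes G: "jordan_curve G" and cont: "continuous_on G f" and inj: "inj_on f G"
  shows "jordan_curve (f ` G)"
proof -
  obtain c where c: "simple_path c" "pathfinish c = pathstart c" "path_image c = G"
    using G unfolding jordan_curve_def by blast
  have "simple_path (f \<circ> c)"
    using c cont inj by (intro simple_path_continuous_image) auto
  moreover have "pathfinish (f \<circ> c) = pathstart (f \<circ> c)"
    using c by (simp add: pathfinish_compose pathstart_compose)
  ultimately show ?thesis
    unfolding jordan_curve_def using c(3) path_image_compose by metis
qed

lemma jordan_curve_sphere:
  assumes "0 < r" shows "jordan_curve (sphere (0::complex) r)" "inside (sphere (0::complex) r) = ball 0 r"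
proof -
  have "simple_path (circlepath (0::complex) r)" using assms by (simp add: simple_path_circlepath)
  then show "jordan_curve (sphere (0::complex) r)"
    unfolding jordan_curve_def using assms
    by (intro exI[of _ "circlepath 0 r"]) auto
  show "inside (sphere (0::complex) r) = ball 0 r"
    using inside_frontier_eq_interior[of "cball (0::complex) r"] assms by simp
qed

lemma connected_avoiding_jordan:
  assumes "jordan_curve G" "connected C" "C \<inter> G = {}"
  shows "C \<subseteq> inside G \<or> C \<subseteq> outside G"
proof (rule ccontr)
  note J = jordan_curveD[OF assms(1)]
  assume "\<not> ?thesis"
  then have "inside G \<inter> C \<noteq> {}" "outside G \<inter> C \<noteq> {}" using J(13) assms(3) by blast+
  moreover have "C \<subseteq> inside G \<union> outside G" "inside G \<inter> outside G \<inter> C = {}" using J(12,13) assms(3) by blast+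
  ultimately show False using connectedD[OF assms(2) J(5,9)] by blast
qed

lemma jordan_inside_nested:
  assumes A: "jordan_curve A" and B: "jordan_curve B" and BA: "B \<subseteq> inside A"
  shows "filled B \<subseteq> inside A" "outside A \<subseteq> outside B" "A \<subseteq> outside B"
proof -
  note JA = jordan_curveD[OF A] note JB = jordan_curveD[OF B]
  have "outside A \<inter> B = {}" using BA JA(12) by blast
  then have "outside A \<subseteq> inside B \<or> outside A \<subseteq> outside B"
    using connected_avoiding_jordan[OF B JA(10)] by blast
  then show 1: "outside A \<subseteq> outside B" using JA(11) JB(7) bounded_subset by blast
  then have "closure (outside A) \<subseteq> closure (outside B)" by (rule closure_mono)
  then have "A \<subseteq> outside B \<union> B" using JA(15) JB(15) by blast
  then show 2: "A \<subseteq> outside B" using BA inside_no_overlap[of A] by blast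
  show "filled B \<subseteq> inside A"
  proof
    fix x assume "x \<in> filled B"
    then have "x \<notin> outside B" by (simp add: filled_compl_outside)
    then show "x \<in> inside A" using 1 2 JA(13) by blast
  qed
qed

text \<open>The delicate case is that each curve is exterior to the other.  If the interiors met, one of them
  would contain the other, and then its closure would contain the other curve.\<close>

lemma jordan_trichotomy:
  assumes A: "jordan_curve A" and B: "jordan_curve B" and AB: "A \<inter> B = {}"
  shows "filled B \<subseteq> inside A \<or> filled A \<subseteq> inside B \<or> filled A \<inter> filled B = {}"
proof (cases "B \<subseteq> inside A \<or> A \<subseteq> inside B")
  case True then show ?thesis using jordan_inside_nested[OF A B] jordan_inside_nested[OF B A] by blast
next
  case False
  note JA = jordan_curveD[OF A] note JB = jordan_curveD[OF B]
  have Bo: "B \<subseteq> outside A" using False connected_avoiding_jordan[OF A JB(2)] AB by blast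
  have Ao: "A \<subseteq> outside B" using False connected_avoiding_jordan[OF B JA(2)] AB by blast
  have "inside A \<inter> B = {}" using Bo JA(12) by blast
  then have "inside A \<subseteq> inside B \<or> inside A \<subseteq> outside B"
    using connected_avoiding_jordan[OF B JA(6)] by blast
  moreover have "\<not> inside A \<subseteq> inside B"
  proof
    assume "inside A \<subseteq> inside B"
    then have "closure (inside A) \<subseteq> closure (inside B)" by (rule closure_mono)
    then have "A \<subseteq> filled B" using JA(14) JB(14) unfolding filled_def by blast
    then show False using Ao JA(3) by (auto simp: filled_compl_outside)
  qed
  ultimately have "filled A \<subseteq> outside B" using Ao unfolding filled_def by blast
  then show ?thesis by (auto simp: filled_compl_outside)
qed

lemma filled_subset_inside_irrefl:
  assumes "jordan_curve G" shows "\<not> filled G \<subseteq> inside G"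
  using jordan_curveD(3)[OF assms] inside_no_overlap[of G] unfolding filled_def by blast

lemma connected_clopen_eq:
  assumes "connected W" "open U" "open C" "U \<subseteq> W" "U \<noteq> {}" "W \<subseteq> U \<union> C" "U \<inter> C = {}"
  shows "U = W"
proof (rule ccontr)
  assume "U \<noteq> W"
  then have "C \<inter> W \<noteq> {}" "U \<inter> W \<noteq> {}" "U \<inter> C \<inter> W = {}" using assms(4-7) by blast+
  then show False using connectedD[OF assms(1-3)] assms(6) by blast
qed

text \<open>The image of the interior is open by invariance of domain, and relatively closed off the image
  curve by compactness.  Hence it is one of the two complementary components of the image curve,
  and it is the bounded one.\<close>

lemma image_inside_jordan:
  fixes f :: "complex \<Rightarrow> complex"
  assumes G: "jordan_curve G" and cont: "continuous_on (filled G) f" and inj: "inj_on f (filled G)"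
  shows "f ` inside G = inside (f ` G)"
proof -
  note J = jordan_curveD[OF G] note F = filled_props[OF G]
  have G': "jordan_curve (f ` G)"
    using jordan_curve_image[OF G] F(5) cont inj continuous_on_subset inj_on_subset by blast
  note J' = jordan_curveD[OF G']
  let ?U = "f ` inside G"
  have op: "open ?U"
    using invariance_of_domain[OF continuous_on_subset[OF cont F(4)] J(5) inj_on_subset[OF inj F(4)]] .
  have disj: "?U \<inter> f ` G = {}"
    using inj F(4,5) inside_no_overlap[of G] unfolding inj_on_def by blast
  have split: "f ` filled G = ?U \<union> f ` G" unfolding filled_def by blast
  have comp: "compact (f ` filled G)" using compact_continuous_image[OF cont F(1)] .
  have con: "connected ?U"
    using connected_continuous_image[OF continuous_on_subset[OF cont F(4)] J(6)] .
  have clo: "open (- (f ` filled G))" using comp compact_imp_closed by blast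
  have bdd: "bounded ?U" using comp compact_imp_bounded bounded_subset split by (metis Un_upper1)
  have sub: "?U \<subseteq> inside (f ` G) \<or> ?U \<subseteq> outside (f ` G)"
    using connected_avoiding_jordan[OF G' con disj] .
  have whole: "?U = W" if W: "connected W" "?U \<subseteq> W" "W \<inter> f ` G = {}" for W
  proof (rule connected_clopen_eq[OF W(1) op clo W(2)])
    show "?U \<noteq> {}" using J(4) by simp
    show "W \<subseteq> ?U \<union> - f ` filled G" unfolding split using W(3) by blast
    show "?U \<inter> - f ` filled G = {}" unfolding split by blast
  qed
  from sub show ?thesis
  proof
    assume "?U \<subseteq> inside (f ` G)"
    then show ?thesis using whole[OF J'(6)] inside_no_overlap[of "f ` G"] by blast
  next
    assume "?U \<subseteq> outside (f ` G)"
    then have "?U = outside (f ` G)" using whole[OF J'(10)] outside_no_overlap[of "f ` G"] by blast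
    then show ?thesis using bdd J'(11) by simp
  qed
qed

text \<open>With a pole in the interior the argument is the same, except that relative closedness needs the
  values to tend to infinity at the pole; and now the image of the punctured interior is unbounded.\<close>

lemma image_inside_jordan_pole:
  fixes f :: "complex \<Rightarrow> complex"
  assumes G: "jordan_curve G" and P: "P \<in> inside G"
    and cont: "continuous_on (filled G - {P}) f" and inj: "inj_on f (filled G - {P})"
    and lim: "filterlim f at_infinity (at P)"
  shows "f ` (inside G - {P}) = outside (f ` G)"
proof -
  note J = jordan_curveD[OF G] note F = filled_props[OF G]
  have PG: "P \<notin> G" using P inside_no_overlap[of G] by blast
  have GP: "G \<subseteq> filled G - {P}" using PG F(5) by blast
  have IP: "inside G - {P} \<subseteq> filled G - {P}" using F(4) by blast
  have G': "jordan_curve (f ` G)"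
    using jordan_curve_image[OF G continuous_on_subset[OF cont GP] inj_on_subset[OF inj GP]] .
  note J' = jordan_curveD[OF G']
  let ?U = "f ` (inside G - {P})"
  have op: "open ?U"
    using invariance_of_domain[OF continuous_on_subset[OF cont IP] _ inj_on_subset[OF inj IP]] J(5)
    by blast
  have disj: "?U \<inter> f ` G = {}"
    using inj IP GP inside_no_overlap[of G] unfolding inj_on_def by blast
  have con: "connected ?U"
    using connected_continuous_image[OF continuous_on_subset[OF cont IP]]
      connected_open_delete[OF J(5,6)] by simp
  have split: "f ` (filled G - {P}) = ?U \<union> f ` G" unfolding filled_def using PG by blast
  have clo: "open (- (?U \<union> f ` G))"
  proof -
    have "closed (f ` (filled G - {P}))"
      unfolding closed_sequential_limits
    proof (intro allI impI)
      fix x l assume x: "(\<forall>n. x n \<in> f ` (filled G - {P})) \<and> x \<longlonglongrightarrow> l"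
      then have "\<forall>n. \<exists>z. z \<in> filled G - {P} \<and> x n = f z" by blast
      then obtain z where z: "\<And>n. z n \<in> filled G - {P}" "\<And>n. x n = f (z n)" by metis
      obtain y r where y: "y \<in> filled G" "strict_mono r" "(z \<circ> r) \<longlonglongrightarrow> y"
        using F(1) z(1) unfolding compact_def by (metis DiffD1)
      have xr: "(\<lambda>n. f (z (r n))) \<longlonglongrightarrow> l"
        using x y(2) z(2) LIMSEQ_subseq_LIMSEQ[of x l r] by (simp add: o_def)
      have "y \<noteq> P"
      proof
        assume "y = P"
        then have "filterlim (\<lambda>n. z (r n)) (at P) sequentially"
          using y(3) z(1) by (auto simp: filterlim_at o_def)
        then have "filterlim (\<lambda>n. f (z (r n))) at_infinity sequentially"
          using filterlim_compose[OF lim] by blast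
        then show False using xr not_tendsto_and_filterlim_at_infinity by (metis trivial_limit_sequentially)
      qed
      then have yP: "y \<in> filled G - {P}" using y by blast
      have "(\<lambda>n. f (z (r n))) \<longlonglongrightarrow> f y"
        using continuous_on_tendsto_compose[OF cont y(3) yP] z(1) by (simp add: o_def)
      then have "l = f y" using xr LIMSEQ_unique by blast
      then show "l \<in> f ` (filled G - {P})" using yP by blast
    qed
    then show ?thesis using split by (metis open_Compl)
  qed
  have unb: "\<not> bounded ?U"
  proof
    assume "bounded ?U"
    then obtain b where b: "\<And>w. w \<in> ?U \<Longrightarrow> norm w \<le> b" unfolding bounded_iff by blast
    have "\<forall>\<^sub>F z in at P. z \<in> inside G - {P}"
      using eventually_at_in_open[OF J(5) P] .
    moreover have "\<forall>\<^sub>F z in at P. norm (f z) \<ge> b + 1"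
      using lim unfolding filterlim_at_infinity_conv_norm_at_top filterlim_at_top by blast
    ultimately have "\<forall>\<^sub>F z in at P. False"
      by eventually_elim (use b in fastforce)
    then show False by simp
  qed
  have ne: "?U \<noteq> {}" using unb bounded_empty by metis
  have sub: "?U \<subseteq> inside (f ` G) \<or> ?U \<subseteq> outside (f ` G)"
    using connected_avoiding_jordan[OF G' con disj] .
  then have sub: "?U \<subseteq> outside (f ` G)" using unb J'(7) bounded_subset by blast
  show ?thesis
  proof (rule connected_clopen_eq[OF J'(10) op clo sub ne])
    show "outside (f ` G) \<subseteq> ?U \<union> - (?U \<union> f ` G)" using outside_no_overlap[of "f ` G"] by blast
  qed blast
qed

text \<open>Each removal is an instance of Janiszewski's theorem: neither the new closed disc nor the
  complement of what is left so far separates the plane, and they are disjoint.\<close>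

lemma connected_inside_minus_filled:
  assumes A: "jordan_curve A" and B: "\<And>i. i < (n::nat) \<Longrightarrow> jordan_curve (B i)"
    and sub: "\<And>i. i < n \<Longrightarrow> filled (B i) \<subseteq> inside A"
    and disj: "\<And>i j. i < j \<Longrightarrow> j < n \<Longrightarrow> filled (B i) \<inter> filled (B j) = {}"
  shows "connected (inside A - (\<Union>i<n. filled (B i)))"
  using B sub disj
proof (induction n)
  case 0 then show ?case using jordan_curveD(6)[OF A] by simp
next
  case (Suc n)
  let ?T = "- (inside A - (\<Union>i<n. filled (B i)))"
  have clo: "closed ?T"
  proof -
    have "closed (\<Union>i<n. filled (B i))"
      by (intro closed_UN ballI compact_imp_closed filled_props(1) Suc.prems(1)) auto
    then show ?thesis using jordan_curveD(5)[OF A] by (metis closed_Compl open_Diff)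
  qed
  have IH: "connected (inside A - (\<Union>i<n. filled (B i)))"
    by (rule Suc.IH) (use Suc.prems in auto)
  have "filled (B n) \<inter> ?T = {}"
    using Suc.prems(2)[of n] Suc.prems(3)[of _ n] by fastforce
  then have "connected (- (filled (B n) \<union> ?T))"
    using Suc.prems(1)[of n] filled_props(1,3)[of "B n"] clo IH
    by (intro Janiszewski_connected) (simp_all only: double_compl connected_empty lessI)
  moreover have "- (filled (B n) \<union> ?T) = inside A - (\<Union>i<Suc n. filled (B i))"
    by (auto simp: less_Suc_eq)
  ultimately show ?case by simp
qed

section \<open>Cycles of invariant curves of a map with an omitted value\<close>

text \<open>The data that a cycle of Herman rings leaves behind once one invariant curve has been chosen
  in every ring.  Indices are all natural numbers, read modulo the period.  \<open>F\<close> is a meromorphic map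
  with pole set \<open>Pol\<close>, whose values at the poles are arbitrary.  The hypothesis \<open>S_max\<close> is what remains
  of the fact that the \<open>S i\<close> are Fatou components, and \<open>S_sides\<close> what remains of the rotation: the
  return map preserves each side of the invariant curve.\<close>

locale curve_cycle =
  fixes F :: "complex \<Rightarrow> complex" and Pol :: "complex set" and v :: complex
    and p :: nat and S G :: "nat \<Rightarrow> complex set"
  assumes p_pos: "0 < p"
    and F_hol: "F holomorphic_on - Pol"
    and F_pole: "\<And>P. P \<in> Pol \<Longrightarrow> filterlim F at_infinity (at P)"
    and F_omits: "\<And>z. z \<notin> Pol \<Longrightarrow> F z \<noteq> v"
    and S_open: "\<And>i. open (S i)"
    and S_disj: "\<And>i j. i mod p \<noteq> j mod p \<Longrightarrow> S i \<inter> S j = {}"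
    and S_pole: "\<And>i. S i \<inter> Pol = {}"
    and S_step: "\<And>i z. z \<in> S i \<Longrightarrow> F z \<in> S (Suc i)"
    and S_inj: "\<And>i. inj_on F (S i)"
    and S_max: "\<And>i U. open U \<Longrightarrow> connected U \<Longrightarrow> U \<inter> S i \<noteq> {} \<Longrightarrow>
        (\<And>n z. z \<in> U \<Longrightarrow> (F ^^ n) z \<notin> Pol) \<Longrightarrow> bounded (\<Union>n. (F ^^ n) ` U) \<Longrightarrow> U \<subseteq> S i"
    and S_sides: "\<And>i z. z \<in> S i - G i \<Longrightarrow>
        \<exists>C. connected C \<and> C \<subseteq> S i - G i \<and> z \<in> C \<and> (\<forall>t. (F ^^ (p * t)) z \<in> C)"
    and G_jordan: "\<And>i. jordan_curve (G i)"
    and G_sub: "\<And>i. G i \<subseteq> S i"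
    and G_step: "\<And>i. F ` G i = G (Suc i)"
    and G_per: "\<And>i. G (i + p) = G i"
    and G_inside: "\<not> inside (G 0) \<subseteq> S 0"
    and F_inj: "\<And>i. inj_on F (filled (G i) - Pol)"
    and one_pole: "\<And>i P P'. P \<in> Pol \<inter> filled (G i) \<Longrightarrow> P' \<in> Pol \<inter> filled (G i) \<Longrightarrow> P = P'"
begin

abbreviation D :: "nat \<Rightarrow> complex set" where "D i \<equiv> inside (G i)"
abbreviation Dbar :: "nat \<Rightarrow> complex set" where "Dbar i \<equiv> filled (G i)"

lemma G_mod: "i mod p = j mod p \<Longrightarrow> G i = G j"
proof -
  have "G (i + p * t) = G i" for i t
  proof (induction t)
    case (Suc t)
    have "i + p * Suc t = (i + p * t) + p" by simp
    then show ?case using Suc G_per by metis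
  qed simp
  then have "G i = G (i mod p)" for i by (metis add.commute mult_div_mod_eq)
  then show "i mod p = j mod p \<Longrightarrow> G i = G j" by metis
qed

lemma G_disj: "i mod p \<noteq> j mod p \<Longrightarrow> G i \<inter> G j = {}"
  using S_disj[of i j] G_sub by blast

lemma trichotomy:
  "i mod p \<noteq> j mod p \<Longrightarrow> Dbar j \<subseteq> D i \<or> Dbar i \<subseteq> D j \<or> Dbar i \<inter> Dbar j = {}"
  using jordan_trichotomy[OF G_jordan G_jordan G_disj] .

lemma G_pole: "G i \<inter> Pol = {}" using G_sub S_pole by blast

lemma D_Dbar: "D i \<subseteq> Dbar i" "G i \<subseteq> Dbar i" "Dbar i = D i \<union> G i"
  unfolding filled_def by auto

lemma Dbar_Pol: "Dbar i \<inter> Pol = D i \<inter> Pol"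
  using G_pole[of i] unfolding filled_def by blast

lemma F_cont: "A \<inter> Pol = {} \<Longrightarrow> continuous_on A F"
  using holomorphic_on_imp_continuous_on[OF F_hol] continuous_on_subset by blast

lemma G_iter: "(F ^^ n) ` G i = G (i + n)"
proof (induction n)
  case (Suc n)
  have "(F ^^ Suc n) ` G i = F ` ((F ^^ n) ` G i)" by (simp add: image_comp)
  then show ?case using Suc G_step by simp
qed simp

lemma S_iter: "z \<in> S i \<Longrightarrow> (F ^^ n) z \<in> S (i + n)"
  by (induction n) (auto simp: S_step)

lemma S_iter_inj: "inj_on (F ^^ n) (S i)"
proof (induction n)
  case (Suc n)
  have "inj_on F ((F ^^ n) ` S i)"
    using S_inj[of "i + n"] S_iter[of _ i n] by (meson image_subsetI inj_on_subset)
  then show ?case using comp_inj_on[OF Suc] by (simp add: comp_def)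
qed simp

text \<open>Some point of \<open>G i\<close> has the same image as \<open>z\<close>, and the iterates are injective on \<open>S i\<close>.\<close>

lemma iter_into_G:
  assumes "z \<in> S i" "(F ^^ n) z \<in> G j" "(i + n) mod p = j mod p"
  shows "z \<in> G i"
proof -
  have "(F ^^ n) z \<in> (F ^^ n) ` G i" using assms G_iter G_mod by metis
  then obtain y where "y \<in> G i" "(F ^^ n) z = (F ^^ n) y" by blast
  then show ?thesis using S_iter_inj[of n i] assms(1) G_sub[of i] unfolding inj_on_def by blast
qed

lemma S_meets_D: "S i \<inter> D i \<noteq> {}"
proof -
  note J = jordan_curveD[OF G_jordan[of i]]
  obtain g where g: "g \<in> G i" using J(3) by blast
  then have gS: "g \<in> S i" using G_sub by blast
  have "g \<in> closure (D i)" using g J(14) D_Dbar(2) by auto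
  then show ?thesis using open_Int_closure_eq_empty[OF S_open[of i]] gS by blast
qed

subsection \<open>Images of the filled curves\<close>

lemma image_D_no_pole:
  assumes "D i \<inter> Pol = {}"
  shows "F ` D i = D (Suc i)" "F ` Dbar i = Dbar (Suc i)" "v \<notin> Dbar (Suc i)"
proof -
  have np: "Dbar i \<inter> Pol = {}" using assms Dbar_Pol by blast
  then have "inj_on F (Dbar i)" using F_inj[of i] by (simp add: Diff_triv)
  then show 1: "F ` D i = D (Suc i)"
    using image_inside_jordan[OF G_jordan F_cont[OF np]] G_step by simp
  then show 2: "F ` Dbar i = Dbar (Suc i)"
    unfolding filled_def by (simp add: image_Un G_step)
  have "v \<notin> F ` Dbar i" using np F_omits by (metis disjoint_iff imageE)
  then show "v \<notin> Dbar (Suc i)" using 2 by simp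
qed

lemma image_D_pole:
  assumes "P \<in> D i" "P \<in> Pol"
  shows "F ` (D i - {P}) = outside (G (Suc i))" "v \<in> D (Suc i)"
proof -
  have eq: "Dbar i \<inter> Pol = {P}" using one_pole[of P i] assms D_Dbar(1)[of i] by blast
  then have D: "Dbar i - {P} = Dbar i - Pol" by blast
  have cont: "continuous_on (Dbar i - Pol) F" by (rule F_cont) blast
  show 1: "F ` (D i - {P}) = outside (G (Suc i))"
    using image_inside_jordan_pole[OF G_jordan assms(1) _ _ F_pole[OF assms(2)]]
      cont F_inj[of i] G_step[of i] unfolding D by simp
  have "(D i - {P}) \<inter> Pol = {}" using eq D_Dbar(1)[of i] by blast
  then have "v \<notin> F ` (D i - {P})" "v \<notin> F ` G i"
    using F_omits G_pole[of i] by (metis disjoint_iff imageE)+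
  then have "v \<notin> outside (G (Suc i))" "v \<notin> G (Suc i)" using 1 G_step by simp_all
  then show "v \<in> D (Suc i)" using jordan_curveD(13)[OF G_jordan, of "Suc i"] by blast
qed

lemma iterate_D_no_pole:
  assumes "\<And>j. j < n \<Longrightarrow> D (i + j) \<inter> Pol = {}"
  shows "(F ^^ n) ` Dbar i = Dbar (i + n)" "inj_on (F ^^ n) (Dbar i)"
    "(F ^^ n) ` D i = D (i + n)" "continuous_on (Dbar i) (F ^^ n)" "(F ^^ n) holomorphic_on D i"
    "\<And>j z. j < n \<Longrightarrow> z \<in> Dbar i \<Longrightarrow> (F ^^ j) z \<notin> Pol"
proof -
  have "(F ^^ n) ` Dbar i = Dbar (i + n) \<and> inj_on (F ^^ n) (Dbar i) \<and>
    (F ^^ n) ` D i = D (i + n) \<and> continuous_on (Dbar i) (F ^^ n) \<and> (F ^^ n) holomorphic_on D i \<and>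
    (\<forall>j z. j < n \<longrightarrow> z \<in> Dbar i \<longrightarrow> (F ^^ j) z \<notin> Pol)"
    using assms
  proof (induction n)
    case 0 then show ?case by (simp add: id_def[symmetric] inj_on_id)
  next
    case (Suc n)
    then have IH: "(F ^^ n) ` Dbar i = Dbar (i + n)" "inj_on (F ^^ n) (Dbar i)"
      "(F ^^ n) ` D i = D (i + n)" "continuous_on (Dbar i) (F ^^ n)" "(F ^^ n) holomorphic_on D i"
      "\<And>j z. j < n \<Longrightarrow> z \<in> Dbar i \<Longrightarrow> (F ^^ j) z \<notin> Pol" by auto
    have np: "D (i + n) \<inter> Pol = {}" "Dbar (i + n) \<inter> Pol = {}" using Suc.prems[of n] Dbar_Pol by auto
    have fs: "F ^^ Suc n = F \<circ> (F ^^ n)" by simp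
    have injF: "inj_on F (Dbar (i + n))" using F_inj[of "i + n"] np(2) by (simp add: Diff_triv)
    have "(F ^^ Suc n) ` Dbar i = Dbar (i + Suc n)" "(F ^^ Suc n) ` D i = D (i + Suc n)"
      unfolding fs image_comp[symmetric] IH using image_D_no_pole[OF np(1)] by auto
    moreover have "inj_on (F ^^ Suc n) (Dbar i)"
      unfolding fs using comp_inj_on[OF IH(2)] injF IH(1) by simp
    moreover have "continuous_on (Dbar i) (F ^^ Suc n)"
      unfolding fs using continuous_on_compose[OF IH(4)] F_cont[OF np(2)] IH(1) by simp
    moreover have "(F ^^ Suc n) holomorphic_on D i"
      unfolding fs using holomorphic_on_compose_gen[OF IH(5) F_hol] IH(3) np(1) by blast
    moreover have "(F ^^ j) z \<notin> Pol" if "j < Suc n" "z \<in> Dbar i" for j z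
      using that IH(1,6) np(2) by (cases "j = n") auto
    ultimately show ?case by blast
  qed
  then show "(F ^^ n) ` Dbar i = Dbar (i + n)" "inj_on (F ^^ n) (Dbar i)"
    "(F ^^ n) ` D i = D (i + n)" "continuous_on (Dbar i) (F ^^ n)" "(F ^^ n) holomorphic_on D i"
    "\<And>j z. j < n \<Longrightarrow> z \<in> Dbar i \<Longrightarrow> (F ^^ j) z \<notin> Pol" by blast+
qed

lemma bounded_Union_Dbar: "bounded (\<Union>i. Dbar i)"
proof -
  have "bounded (\<Union>i<p. Dbar i)"
    using filled_props(1)[OF G_jordan] compact_imp_bounded by (intro bounded_UN) auto
  moreover have "(\<Union>i. Dbar i) = (\<Union>i<p. Dbar i)"
  proof
    show "(\<Union>i. Dbar i) \<subseteq> (\<Union>i<p. Dbar i)"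
    proof (rule UN_least)
      fix i
      have "Dbar i = Dbar (i mod p)" using G_mod[of i "i mod p"] by simp
      then show "Dbar i \<subseteq> (\<Union>i<p. Dbar i)"
        using p_pos by (metis UN_upper lessThan_iff mod_less_divisor)
    qed
  qed blast
  ultimately show ?thesis by simp
qed

text \<open>If there were no pole inside any of the curves, all iterates would be bounded inside \<open>G 0\<close>, and
  the Fatou component \<open>S 0\<close> would contain that whole disc, hole of the ring included.\<close>

lemma ex_pole: "\<exists>i. D i \<inter> Pol \<noteq> {}"
proof (rule ccontr)
  assume "\<not> ?thesis"
  then have np: "\<And>i. D i \<inter> Pol = {}" by blast
  have "D 0 \<subseteq> S 0"
  proof (rule S_max)
    show "open (D 0)" "connected (D 0)" using jordan_curveD[OF G_jordan] by auto
    show "D 0 \<inter> S 0 \<noteq> {}" using S_meets_D by blast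
    show "(F ^^ n) z \<notin> Pol" if "z \<in> D 0" for n z
      using iterate_D_no_pole(3)[of n 0] np that by (metis add_0 disjoint_iff imageI)
    have "(F ^^ n) ` D 0 \<subseteq> (\<Union>i. Dbar i)" for n
      using iterate_D_no_pole(3)[of n 0, OF np] D_Dbar(1)[of n] by auto
    then show "bounded (\<Union>n. (F ^^ n) ` D 0)"
      using bounded_Union_Dbar by (meson UN_least bounded_subset)
  qed
  then show False using G_inside by blast
qed

text \<open>Any two discs that contain the omitted value are nested, so there is an outermost one.\<close>

lemma ex_outermost:
  obtains m where "v \<in> D m" "\<And>k. v \<in> D k \<Longrightarrow> k mod p \<noteq> m mod p \<Longrightarrow> Dbar k \<subseteq> D m"
proof -
  obtain i P where "P \<in> D i" "P \<in> Pol" using ex_pole by blast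
  then have "v \<in> D (Suc i)" using image_D_pole by blast
  define A where "A = D ` {k. k < p \<and> v \<in> D k}"
  have fin: "finite A" unfolding A_def by simp
  have modA: "D k \<in> A" if "v \<in> D k" for k
    unfolding A_def using that G_mod[of k "k mod p"] p_pos by (intro image_eqI[of _ _ "k mod p"]) auto
  have "A \<noteq> {}" using modA[OF \<open>v \<in> D (Suc i)\<close>] by blast
  then obtain X where X: "X \<in> A" "\<And>Y. Y \<in> A \<Longrightarrow> X \<subseteq> Y \<Longrightarrow> X = Y"
    using finite_has_maximal[OF fin] by metis
  then obtain m where m: "X = D m" "v \<in> D m" unfolding A_def by blast
  show ?thesis
  proof (rule that[OF m(2)])
    fix k assume k: "v \<in> D k" "k mod p \<noteq> m mod p"
    have "\<not> Dbar m \<subseteq> D k"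
    proof
      assume sub: "Dbar m \<subseteq> D k"
      then have "D m = D k" using X(2)[OF modA[OF k(1)]] m(1) D_Dbar(1)[of m] by blast
      then show False using sub filled_subset_inside_irrefl[OF G_jordan, of m] by simp
    qed
    then show "Dbar k \<subseteq> D m" using trichotomy[of k m] k m(2) D_Dbar(1) by blast
  qed
qed

end

section \<open>The return from the outermost disc\<close>

text \<open>\<open>D m\<close> is the outermost disc that contains the omitted value, \<open>s\<close> is the first time at which its
  orbit covers a pole, and \<open>P0\<close> is the point of \<open>D m\<close> that is sent to that pole.\<close>

locale outermost_return = curve_cycle +
  fixes m s :: nat and P0 :: complex
  assumes v_m: "v \<in> inside (G m)"
    and outermost: "\<And>k. v \<in> inside (G k) \<Longrightarrow> k mod p \<noteq> m mod p \<Longrightarrow> filled (G k) \<subseteq> inside (G m)"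
    and before_s: "\<And>j. j < s \<Longrightarrow> inside (G (m + j)) \<inter> Pol = {}"
    and P0_in: "P0 \<in> inside (G m)"
    and P0_pole: "(F ^^ s) P0 \<in> Pol"
begin

text \<open>On \<open>D m\<close> this map has the single pole \<open>P0\<close>.\<close>

definition R :: "complex \<Rightarrow> complex" where "R = F ^^ Suc s"

text \<open>The discs \<open>D (q 0)\<close>, \<open>D (q 1)\<close>, ... are the successive images under \<open>R\<close> of the disc \<open>D (q 0)\<close>
  that \<open>R\<close> omits on \<open>D m\<close>.\<close>

definition q :: "nat \<Rightarrow> nat" where "q i = m + Suc s * Suc i"

lemma q_simps: "q 0 = m + Suc s" "q (Suc i) = q i + Suc s"
  unfolding q_def by simp_all

lemma R_G: "R ` G k = G (k + Suc s)" unfolding R_def by (rule G_iter)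

lemma R_power: "R ^^ t = F ^^ (Suc s * t)"
  unfolding R_def by (rule funpow_mult)

lemmas iter_m = iterate_D_no_pole[of _ m]

lemma iter_s:
  "(F ^^ s) ` Dbar m = Dbar (m + s)" "inj_on (F ^^ s) (Dbar m)" "(F ^^ s) ` D m = D (m + s)"
  "continuous_on (Dbar m) (F ^^ s)" "(F ^^ s) holomorphic_on D m"
  "\<And>j z. j < s \<Longrightarrow> z \<in> Dbar m \<Longrightarrow> (F ^^ j) z \<notin> Pol"
  using iterate_D_no_pole[of s m] before_s by blast+

lemma P0_unique: "z \<in> Dbar m \<Longrightarrow> (F ^^ s) z \<in> Pol \<Longrightarrow> z = P0"
proof -
  assume z: "z \<in> Dbar m" "(F ^^ s) z \<in> Pol"
  have P: "P0 \<in> Dbar m" using P0_in D_Dbar(1) by blast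
  have "(F ^^ s) z = (F ^^ s) P0" using one_pole[of _ "m + s"] z P P0_pole iter_s(1) by blast
  then show "z = P0" using iter_s(2) z(1) P unfolding inj_on_def by blast
qed

lemma P0_not_G: "P0 \<notin> G k"
proof
  assume "P0 \<in> G k"
  then have "(F ^^ s) P0 \<in> G (k + s)" using G_iter by blast
  then show False using G_pole P0_pole by blast
qed

lemma P0_not_S: "P0 \<notin> S k"
  using S_iter[of P0 k s] S_pole[of "k + s"] P0_pole by blast

lemma iter_s_image: "(F ^^ s) ` (Dbar m - {P0}) \<subseteq> Dbar (m + s) - Pol"
  using iter_s(1) P0_unique by blast

lemma R_comp: "R = F \<circ> (F ^^ s)" unfolding R_def by simp

lemma R_cont: "continuous_on (Dbar m - {P0}) R"
proof -
  have "continuous_on (Dbar m - {P0}) (F ^^ s)" using iter_s(4) continuous_on_subset by blast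
  moreover have "continuous_on ((F ^^ s) ` (Dbar m - {P0})) F"
    using iter_s_image by (intro F_cont) blast
  ultimately show ?thesis unfolding R_comp by (rule continuous_on_compose)
qed

lemma R_inj: "inj_on R (Dbar m - {P0})"
  unfolding R_comp
proof (rule comp_inj_on)
  show "inj_on (F ^^ s) (Dbar m - {P0})" using iter_s(2) inj_on_subset by blast
  show "inj_on F ((F ^^ s) ` (Dbar m - {P0}))" using F_inj iter_s_image inj_on_subset by blast
qed

lemma R_hol: "R holomorphic_on D m - {P0}"
proof -
  have "(F ^^ s) holomorphic_on D m - {P0}" using iter_s(5) holomorphic_on_subset by blast
  moreover have "(F ^^ s) ` (D m - {P0}) \<subseteq> - Pol" using iter_s_image D_Dbar(1) by blast
  ultimately show ?thesis unfolding R_comp using holomorphic_on_compose_gen[OF _ F_hol] by blast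
qed

lemma R_omits: "v \<notin> R ` (Dbar m - {P0})"
proof
  assume "v \<in> R ` (Dbar m - {P0})"
  then obtain z where "z \<in> Dbar m - {P0}" "v = F ((F ^^ s) z)" unfolding R_comp by auto
  moreover from this have "(F ^^ s) z \<notin> Pol" using P0_unique by blast
  ultimately show False using F_omits by metis
qed

lemma R_lim: "filterlim R at_infinity (at P0)"
proof -
  have op: "open (D m)" using jordan_curveD[OF G_jordan] by blast
  have "isCont (F ^^ s) P0"
    using iter_s(4) D_Dbar(1) P0_in op continuous_on_interior continuous_on_subset
    by (metis interior_open)
  then have "((F ^^ s) \<longlongrightarrow> (F ^^ s) P0) (at P0)" by (simp add: isCont_def)
  moreover have "\<forall>\<^sub>F z in at P0. z \<in> D m - {P0}" using eventually_at_in_open[OF op P0_in] .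
  then have "\<forall>\<^sub>F z in at P0. (F ^^ s) z \<noteq> (F ^^ s) P0"
    by eventually_elim (metis DiffE P0_unique P0_pole D_Dbar(1) singletonI subsetD)
  ultimately have "filterlim (F ^^ s) (at ((F ^^ s) P0)) (at P0)"
    by (simp add: filterlim_at)
  then show ?thesis unfolding R_comp comp_def using filterlim_compose[OF F_pole[OF P0_pole]] by blast
qed

lemma R_image_curve:
  assumes "jordan_curve A" "filled A \<subseteq> Dbar m" "P0 \<notin> filled A"
  shows "R ` inside A = inside (R ` A)" "R ` filled A = filled (R ` A)" "v \<notin> filled (R ` A)"
proof -
  have sub: "filled A \<subseteq> Dbar m - {P0}" using assms by blast
  show 1: "R ` inside A = inside (R ` A)"
    using image_inside_jordan[OF assms(1) continuous_on_subset[OF R_cont sub] inj_on_subset[OF R_inj sub]] .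
  show 2: "R ` filled A = filled (R ` A)" unfolding filled_def image_Un 1 ..
  show "v \<notin> filled (R ` A)" using R_omits sub unfolding 2[symmetric] by blast
qed

lemma R_image_curve_pole:
  assumes "jordan_curve A" "filled A \<subseteq> Dbar m" "P0 \<in> inside A"
  shows "R ` (inside A - {P0}) = outside (R ` A)"
proof -
  have sub: "filled A - {P0} \<subseteq> Dbar m - {P0}" using assms by blast
  show ?thesis
    using image_inside_jordan_pole[OF assms(1,3) continuous_on_subset[OF R_cont sub]
        inj_on_subset[OF R_inj sub] R_lim] .
qed

lemma R_image:
  assumes "Dbar k \<subseteq> Dbar m" "P0 \<notin> D k"
  shows "R ` D k = D (k + Suc s)" "R ` Dbar k = Dbar (k + Suc s)" "v \<notin> Dbar (k + Suc s)"
proof -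
  have "P0 \<notin> Dbar k" using assms(2) P0_not_G D_Dbar(3) by blast
  note R_image_curve[OF G_jordan assms(1) this, unfolded R_G]
  then show "R ` D k = D (k + Suc s)" "R ` Dbar k = Dbar (k + Suc s)" "v \<notin> Dbar (k + Suc s)" .
qed

lemma R_image_pole:
  assumes "Dbar k \<subseteq> Dbar m" "P0 \<in> D k"
  shows "R ` (D k - {P0}) = outside (G (k + Suc s))"
    "R ` (Dbar k - {P0}) = outside (G (k + Suc s)) \<union> G (k + Suc s)" "v \<in> D (k + Suc s)"
proof -
  show 1: "R ` (D k - {P0}) = outside (G (k + Suc s))"
    using R_image_curve_pole[OF G_jordan assms, unfolded R_G] .
  have "Dbar k - {P0} = (D k - {P0}) \<union> G k" using P0_not_G[of k] D_Dbar(3)[of k] by blast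
  then show 2: "R ` (Dbar k - {P0}) = outside (G (k + Suc s)) \<union> G (k + Suc s)"
    by (simp only: image_Un 1 R_G)
  have "v \<notin> R ` (Dbar k - {P0})" using R_omits assms(1) by blast
  then show "v \<in> D (k + Suc s)"
    using jordan_curveD(13)[OF G_jordan, of "k + Suc s"] unfolding 2 by blast
qed

lemmas R_m = R_image_pole[OF order_refl P0_in, folded q_simps(1)]

text \<open>Otherwise \<open>R\<close> would be an iterate of the return map of the ring, and yet map the inner side of
  the invariant curve to the outer one.\<close>

lemma q0_ne_m: "q 0 mod p \<noteq> m mod p"
proof
  assume eq: "q 0 mod p = m mod p"
  then have "p dvd Suc s" unfolding q_simps by (metis mod_eq_dvd_iff_nat le_add1 add_diff_cancel_left')
  then obtain t where t: "Suc s = p * t" by blast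
  obtain z where z: "z \<in> S m" "z \<in> D m" using S_meets_D by blast
  then have zG: "z \<in> S m - G m" using inside_no_overlap[of "G m"] by blast
  obtain C where C: "connected C" "C \<subseteq> S m - G m" "z \<in> C" "\<forall>t. (F ^^ (p * t)) z \<in> C"
    using S_sides[OF zG] by blast
  have "C \<inter> G m = {}" using C(2) by blast
  then have "C \<subseteq> D m"
    using connected_avoiding_jordan[OF G_jordan C(1)] C(3) z(2) jordan_curveD(12)[OF G_jordan, of m]
    by blast
  then have "R z \<in> D m" using C(4) unfolding R_def t by blast
  moreover have "z \<noteq> P0" using z(1) P0_not_S by blast
  then have "R z \<in> outside (G (q 0))" using R_m(1) z(2) by blast
  ultimately show False using jordan_curveD(12)[OF G_jordan, of m] unfolding G_mod[OF eq] by blast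
qed

lemma Dbar_q0: "Dbar (q 0) \<subseteq> D m"
  using outermost[OF R_m(3) q0_ne_m] .

definition leaves :: "nat \<Rightarrow> bool" where
  "leaves i \<longleftrightarrow> P0 \<in> D (q i) \<or> \<not> Dbar (q (Suc i)) \<subseteq> D m"

definition N :: nat where "N = (LEAST i. leaves i)"

text \<open>The images of \<open>D (q 0)\<close> cannot stay inside \<open>D m\<close> and avoid \<open>P0\<close> forever: by periodicity
  \<open>D (q 0)\<close> would recur among them, but it is not in the image of \<open>R\<close>.\<close>

lemma ex_leaves: "\<exists>i. leaves i"
proof (rule ccontr)
  assume "\<not> ?thesis"
  then have np: "\<And>i. P0 \<notin> D (q i)" and sub: "\<And>i. Dbar (q (Suc i)) \<subseteq> D m"
    unfolding leaves_def by auto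
  have subm: "Dbar (q i) \<subseteq> D m" for i using sub Dbar_q0 by (cases i) auto
  obtain t where t: "p = Suc t" using p_pos gr0_conv_Suc by auto
  have "R ` D (q t) = D (q p)"
    using R_image(1)[of "q t"] subm[of t] np[of t] D_Dbar(1)[of m] unfolding t q_simps by blast
  moreover have "D (q t) \<subseteq> D m - {P0}" using subm[of t] np[of t] D_Dbar(1)[of "q t"] by blast
  ultimately have "D (q p) \<subseteq> outside (G (q 0))" using R_m(1) by blast
  moreover have "G (q p) = G (q 0)"
  proof (rule G_mod)
    have "q p = q 0 + p * Suc s" by (simp add: q_def algebra_simps)
    then show "q p mod p = q 0 mod p" by (simp only: mod_mult_self2)
  qed
  ultimately have "D (q 0) \<subseteq> outside (G (q 0))" by simp
  then show False using jordan_curveD(4,12)[OF G_jordan, of "q 0"] by blast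
qed

lemma leaves_N: "leaves N" unfolding N_def using ex_leaves by (metis LeastI)

lemma before_N: "i < N \<Longrightarrow> P0 \<notin> D (q i)" "i < N \<Longrightarrow> Dbar (q (Suc i)) \<subseteq> D m"
  unfolding N_def leaves_def by (metis (no_types, lifting) not_less_Least leaves_def)+

lemma Dbar_q: "i \<le> N \<Longrightarrow> Dbar (q i) \<subseteq> D m"
  using Dbar_q0 before_N(2) by (cases i) auto

lemma Dbar_q_m: "i \<le> N \<Longrightarrow> Dbar (q i) \<subseteq> Dbar m"
  using Dbar_q[of i] D_Dbar(1)[of m] by blast

lemma R_Dbar_q: "i < N \<Longrightarrow> R ` Dbar (q i) = Dbar (q (Suc i))"
  unfolding q_simps using R_image(2)[of "q i"] Dbar_q_m[of i] before_N(1)[of i] by simp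

lemma P0_Dbar_q: "i < N \<Longrightarrow> Dbar (q i) \<subseteq> Dbar m - {P0}"
  using Dbar_q_m[of i] before_N(1)[of i] P0_not_G[of "q i"] D_Dbar(3)[of "q i"] by auto

text \<open>By injectivity of \<open>R\<close>, points with image in \<open>D (q (i + 1))\<close> come from \<open>D (q i)\<close>; and \<open>D (q 0)\<close> is not in
  the image at all.\<close>

lemma R_avoids:
  assumes W: "W \<subseteq> D m - {P0}" "\<And>i. i \<le> N \<Longrightarrow> W \<inter> Dbar (q i) = {}" and i: "i \<le> N"
  shows "R ` W \<inter> Dbar (q i) = {}"
proof (cases i)
  case 0
  have "R ` W \<subseteq> outside (G (q 0))" using W(1) R_m(1) by blast
  then show ?thesis using 0 by (auto simp: filled_compl_outside)
next
  case (Suc j)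
  then have j: "j < N" using i by simp
  show ?thesis
  proof (rule ccontr)
    assume "\<not> ?thesis"
    then obtain w z where "w \<in> W" "z \<in> Dbar (q j)" "R w = R z"
      unfolding Suc R_Dbar_q[OF j, symmetric] by blast
    then have "w = z" using inj_onD[OF R_inj, of w z] P0_Dbar_q[OF j] W(1) D_Dbar(1)[of m] by blast
    then show False using W(2)[of j] j \<open>w \<in> W\<close> \<open>z \<in> Dbar (q j)\<close> by auto
  qed
qed

lemma Dbar_q_disjoint: "i < j \<Longrightarrow> j \<le> N \<Longrightarrow> Dbar (q i) \<inter> Dbar (q j) = {}"
proof (induction i arbitrary: j)
  case 0
  then obtain k where k: "j = Suc k" "k < N" by (metis Suc_le_lessD less_imp_Suc_add add_0)
  have "Dbar (q k) \<subseteq> D m - {P0}"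
    using P0_Dbar_q[OF k(2)] Dbar_q[of k] k(2) by auto
  then have "Dbar (q j) \<subseteq> outside (G (q 0))" using R_Dbar_q[OF k(2)] R_m(1) k(1) by blast
  then show ?case by (auto simp: filled_compl_outside)
next
  case (Suc i)
  then obtain k where k: "j = Suc k" "k < N" "i < k" "i < N" by (cases j) auto
  have "Dbar (q i) \<inter> Dbar (q k) = {}" using Suc.IH k by simp
  then have "R ` Dbar (q i) \<inter> R ` Dbar (q k) = {}"
    using inj_on_image_Int[OF R_inj P0_Dbar_q[OF k(4)] P0_Dbar_q[OF k(2)]] by simp
  then show ?case using R_Dbar_q k by simp
qed

definition Y :: "complex set" where "Y = D m - (\<Union>i<Suc N. Dbar (q i))"

lemma Y_iff: "z \<in> Y \<longleftrightarrow> z \<in> D m \<and> (\<forall>i\<le>N. z \<notin> Dbar (q i))"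
  unfolding Y_def by (auto simp: less_Suc_eq_le)

lemma Y_avoids: "i \<le> N \<Longrightarrow> Y \<inter> Dbar (q i) = {}"
  by (auto simp: Y_iff)

lemma closed_Dbar: "closed (Dbar i)"
  using filled_props(1)[OF G_jordan] compact_imp_closed by blast

lemma Y_open: "open Y"
  unfolding Y_def using jordan_curveD(5)[OF G_jordan] closed_Dbar by (intro open_Diff closed_UN) auto

lemma Y_connected: "connected Y"
  unfolding Y_def using Dbar_q Dbar_q_disjoint
  by (intro connected_inside_minus_filled[of "G m" "Suc N" "\<lambda>i. G (q i)"])
    (auto simp: G_jordan less_Suc_eq_le)

lemma Y_meets_Sm: "Y \<inter> S m \<noteq> {}"
proof -
  let ?W = "S m - (\<Union>i<Suc N. Dbar (q i))"
  have op: "open ?W" using S_open closed_Dbar by (intro open_Diff closed_UN) auto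
  obtain g where g: "g \<in> G m" using jordan_curveD(3)[OF G_jordan] by blast
  then have "g \<notin> D m" using inside_no_overlap[of "G m"] by blast
  then have "g \<notin> Dbar (q i)" if "i \<le> N" for i using Dbar_q[OF that] by blast
  then have "g \<in> ?W" using g G_sub[of m] by (auto simp: less_Suc_eq_le)
  moreover have "g \<in> closure (D m)" using g jordan_curveD(14)[OF G_jordan, of m] D_Dbar(2) by blast
  ultimately have "?W \<inter> D m \<noteq> {}" using open_Int_closure_eq_empty[OF op] by blast
  then show ?thesis unfolding Y_def by blast
qed

lemma Y_meets_Sq0: "Y \<inter> S (q 0) \<noteq> {}"
proof -
  let ?W = "(S (q 0) \<inter> D m) - (\<Union>i\<in>{1..<Suc N}. Dbar (q i))"
  have op: "open ?W" using S_open closed_Dbar jordan_curveD(5)[OF G_jordan, of m]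
    by (intro open_Diff closed_UN) auto
  obtain g where g: "g \<in> G (q 0)" using jordan_curveD(3)[OF G_jordan] by blast
  then have gD: "g \<in> Dbar (q 0)" using D_Dbar(2) by blast
  then have "g \<notin> Dbar (q i)" if "1 \<le> i" "i \<le> N" for i
    using Dbar_q_disjoint[of 0 i] that by auto
  then have "g \<in> ?W" using g gD G_sub[of "q 0"] Dbar_q0 by (auto simp: less_Suc_eq_le)
  moreover have "g \<in> closure (outside (G (q 0)))" using g jordan_curveD(15)[OF G_jordan, of "q 0"] by blast
  ultimately have "?W \<inter> outside (G (q 0)) \<noteq> {}" using open_Int_closure_eq_empty[OF op] by blast
  then obtain z where z: "z \<in> ?W" "z \<in> outside (G (q 0))" by blast
  have "z \<in> Y" unfolding Y_iff
  proof (intro conjI allI impI)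
    fix i assume "i \<le> N"
    then show "z \<notin> Dbar (q i)" using z by (cases "i = 0") (auto simp: filled_compl_outside)
  qed (use z in blast)
  then show ?thesis using z by blast
qed

subsection \<open>The images reach the pole\<close>

text \<open>If \<open>P0\<close> is in the last disc \<open>D (q N)\<close>, the rest of \<open>D m\<close> is mapped to itself by \<open>R\<close>, because
  everything outside \<open>D m\<close> is already taken as values of \<open>R\<close> on \<open>D (q N)\<close>.  So it lies in the Fatou
  set, and links two different rings.\<close>

lemma pole_not_in_last: "P0 \<notin> D (q N)"
proof
  assume P: "P0 \<in> D (q N)"
  have YP: "Y \<subseteq> D m - {P0}" using P D_Dbar(1)[of "q N"] by (auto simp: Y_iff)
  have sub: "Dbar (q N) \<subseteq> Dbar m" using Dbar_q_m by simp
  note RN = R_image_pole[OF sub P, folded q_simps(2)]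
  have Dq: "D (q (Suc N)) \<subseteq> D m"
  proof (cases "q (Suc N) mod p = m mod p")
    case True then show ?thesis using G_mod[OF True] by simp
  next
    case False then show ?thesis using outermost[OF RN(3)] D_Dbar(1)[of "q (Suc N)"] by blast
  qed
  have RY: "R z \<in> Y" if z: "z \<in> Y" for z
  proof -
    have "z \<in> D m - {P0}" using z YP by (rule subsetD[rotated])
    then have zN: "z \<notin> Dbar (q N)" "z \<in> Dbar m" "z \<noteq> P0"
      using z D_Dbar(1)[of m] by (auto simp: Y_iff)
    have "R z \<in> D m"
    proof (rule ccontr)
      assume "R z \<notin> D m"
      then have "R z \<notin> D (q (Suc N))" using Dq by blast
      then have "R z \<in> R ` (Dbar (q N) - {P0})"
        unfolding RN(2) using jordan_curveD(13)[OF G_jordan, of "q (Suc N)"] by blast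
      then obtain y where y: "y \<in> Dbar (q N) - {P0}" "R z = R y" by blast
      then have "z = y" using inj_onD[OF R_inj, of z y] sub zN by blast
      then show False using zN y by blast
    qed
    moreover have "R z \<notin> Dbar (q i)" if "i \<le> N" for i
      using R_avoids[OF YP Y_avoids that] z by blast
    ultimately show ?thesis by (simp add: Y_iff)
  qed
  have RtY: "(R ^^ t) z \<in> Y" if "z \<in> Y" for t z
    by (induction t) (use that RY in auto)
  (* Division with remainder: iterates of R stay in Y, and fewer than Suc s further steps lead into
     one of the discs D (m + r). *)
  have orbit: "\<exists>y\<in>Y. \<exists>r\<le>s. (F ^^ k) z = (F ^^ r) y" if "z \<in> Y" for k z
  proof -
    have "k = k mod Suc s + Suc s * (k div Suc s)"
      by (rule mod_mult_div_eq[symmetric])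
    then have "(F ^^ k) z = (F ^^ (k mod Suc s)) ((R ^^ (k div Suc s)) z)"
      unfolding R_power by (metis comp_apply funpow_add)
    then show ?thesis using RtY[OF that] by (metis less_Suc_eq_le mod_less_divisor zero_less_Suc)
  qed
  have np: "(F ^^ k) z \<notin> Pol" if "z \<in> Y" for k z
  proof -
    obtain y r where y: "y \<in> Y" "r \<le> s" "(F ^^ k) z = (F ^^ r) y"
      using orbit[OF \<open>z \<in> Y\<close>] by blast
    have yD: "y \<in> Dbar m" "y \<noteq> P0" using y(1) YP D_Dbar(1)[of m] by auto
    have "(F ^^ r) y \<notin> Pol"
      using iter_s(6)[of r y] P0_unique[of y] yD y(2) by (cases "r = s") auto
    then show ?thesis using y by simp
  qed
  have bd: "(F ^^ k) z \<in> (\<Union>i. Dbar i)" if "z \<in> Y" for k z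
  proof -
    obtain y r where y: "y \<in> Y" "r \<le> s" "(F ^^ k) z = (F ^^ r) y"
      using orbit[OF \<open>z \<in> Y\<close>] by blast
    have "(F ^^ r) ` Dbar m = Dbar (m + r)" using iter_m(1)[of r] before_s y(2) by simp
    moreover have "y \<in> Dbar m" using y(1) YP D_Dbar(1)[of m] by auto
    ultimately show ?thesis using y(3) by blast
  qed
  have "bounded (\<Union>n. (F ^^ n) ` Y)"
    using bounded_Union_Dbar by (rule bounded_subset) (use bd in blast)
  then have "Y \<subseteq> S i" if "Y \<inter> S i \<noteq> {}" for i
    using S_max[OF Y_open Y_connected that] np by blast
  then have "Y \<subseteq> S m" "Y \<subseteq> S (q 0)" using Y_meets_Sm Y_meets_Sq0 by blast+
  then show False using S_disj[OF q0_ne_m] Y_meets_Sm by blast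
qed

end

context outermost_return
begin

subsection \<open>The images leave the disc\<close>

lemma last_leaves: "Dbar m \<inter> Dbar (q (Suc N)) = {}"
proof -
  have nsub: "\<not> Dbar (q (Suc N)) \<subseteq> D m"
    using leaves_N pole_not_in_last unfolding leaves_def by blast
  have nv: "v \<notin> Dbar (q (Suc N))"
    unfolding q_simps using R_image(3)[of "q N"] Dbar_q_m[of N] pole_not_in_last by simp
  have "q (Suc N) mod p \<noteq> m mod p"
  proof
    assume "q (Suc N) mod p = m mod p"
    then show False using G_mod[of "q (Suc N)" m] nv v_m D_Dbar(1)[of m] by auto
  qed
  from trichotomy[OF this] show ?thesis
    using nsub nv v_m D_Dbar(1)[of m] D_Dbar(1)[of "q (Suc N)"] by blast
qed

lemma R_Dbar_q_last: "i \<le> N \<Longrightarrow> R ` Dbar (q i) = Dbar (q (Suc i))"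
  unfolding q_simps using R_image(2)[of "q i"] Dbar_q_m[of i] before_N(1)[of i] pole_not_in_last
  by (cases "i = N") auto

text \<open>The domain of the inverse of \<open>R\<close>.\<close>

definition X :: "complex set" where "X = outside (G (q 0))"

lemma X_open: "open X"
  unfolding X_def using jordan_curveD[OF G_jordan] by blast

lemma Y_sub_X: "Y \<subseteq> X" and G_sub_X: "G m \<subseteq> X"
proof -
  show "Y \<subseteq> X" using Y_avoids[of 0] unfolding X_def filled_compl_outside by blast
  have "G m \<inter> Dbar (q 0) = {}" using Dbar_q0 inside_no_overlap[of "G m"] by blast
  then show "G m \<subseteq> X" unfolding X_def filled_compl_outside by blast
qed

lemma G_not_Y: "G m \<inter> Y = {}"
  using inside_no_overlap[of "G m"] unfolding Y_def by blast

lemma ex_inverse: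
  obtains h where "h holomorphic_on X" "\<And>x. x \<in> X \<Longrightarrow> h x \<in> D m - {P0}" "\<And>x. x \<in> X \<Longrightarrow> R (h x) = x"
proof -
  have sub: "D m - {P0} \<subseteq> Dbar m - {P0}" using D_Dbar(1) by blast
  have op: "open (D m - {P0})" using jordan_curveD(5)[OF G_jordan] by blast
  obtain h where h: "h holomorphic_on R ` (D m - {P0})" "\<And>z. z \<in> D m - {P0} \<Longrightarrow> h (R z) = z"
    using holomorphic_has_inverse[OF R_hol op inj_on_subset[OF R_inj sub]] by metis
  have X: "R ` (D m - {P0}) = X" unfolding X_def by (rule R_m(1))
  show ?thesis
  proof (rule that[of h])
    show "h holomorphic_on X" using h(1) X by simp
    show "h x \<in> D m - {P0}" if "x \<in> X" for x using that h(2) unfolding X[symmetric] by (metis imageE)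
    show "R (h x) = x" if "x \<in> X" for x using that h(2) unfolding X[symmetric] by (metis imageE)
  qed
qed

end

text \<open>Here \<open>h\<close> is the inverse of \<open>R\<close>.  It maps \<open>Y\<close> into itself, so that all preimages of the curve \<open>G m\<close>
  under iterates of \<open>R\<close> are again Jordan curves, and after the first step they lie in \<open>Y\<close>.\<close>

locale backward_orbit = outermost_return +
  fixes h :: "complex \<Rightarrow> complex"
  assumes h_hol: "h holomorphic_on X"
    and h_in: "\<And>x. x \<in> X \<Longrightarrow> h x \<in> D m - {P0}"
    and R_h: "\<And>x. x \<in> X \<Longrightarrow> R (h x) = x"
begin

lemma h_Y: "x \<in> Y \<union> G m \<Longrightarrow> h x \<in> Y"
proof -
  assume x: "x \<in> Y \<union> G m"
  then have xX: "x \<in> X" using Y_sub_X G_sub_X by blast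
  have "h x \<notin> Dbar (q i)" if i: "i \<le> N" for i
  proof
    assume "h x \<in> Dbar (q i)"
    then have xq: "x \<in> Dbar (q (Suc i))" using R_h[OF xX] R_Dbar_q_last[OF i] by (metis imageI)
    show False
    proof (cases "i = N")
      case True
      have "x \<in> Dbar m" using x D_Dbar[of m] by (auto simp: Y_iff)
      then show False using last_leaves xq True by blast
    next
      case False
      then have "Suc i \<le> N" using i by simp
      have "x \<notin> Y" using xq Y_avoids[OF \<open>Suc i \<le> N\<close>] by blast
      moreover have "x \<notin> G m" using xq Dbar_q[OF \<open>Suc i \<le> N\<close>] inside_no_overlap[of "G m"] by blast
      ultimately show False using x by blast
    qed
  qed
  then show "h x \<in> Y" using h_in[OF xX] by (simp add: Y_iff)
qed

lemma h_power_Y: "x \<in> Y \<Longrightarrow> (h ^^ k) x \<in> Y"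
  by (induction k) (auto simp: h_Y)

text \<open>On such a neighbourhood of the curve all iterates of \<open>h\<close> stay inside \<open>X\<close>, since the first one leads into
  the backward invariant set \<open>Y\<close>.\<close>

lemma ex_neighbourhood:
  obtains T where "open T" "connected T" "G m \<subseteq> T" "T \<subseteq> S m" "T \<subseteq> X" "\<And>x. x \<in> T \<Longrightarrow> h x \<in> Y"
proof -
  define W where "W = S m \<inter> (X \<inter> h -` Y)"
  have "open (X \<inter> h -` Y)"
    using continuous_open_preimage[OF holomorphic_on_imp_continuous_on[OF h_hol] X_open Y_open] .
  then have W: "open W" unfolding W_def using S_open by blast
  have GW: "G m \<subseteq> W" unfolding W_def using G_sub G_sub_X h_Y by auto
  obtain g where g: "g \<in> G m" using jordan_curveD(3)[OF G_jordan] by blast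
  show ?thesis
  proof (rule that[of "connected_component_set W g"])
    show "open (connected_component_set W g)" using open_connected_component[OF W] .
    show "connected (connected_component_set W g)" by simp
    show "G m \<subseteq> connected_component_set W g"
      using connected_component_maximal[OF g jordan_curveD(2)[OF G_jordan] GW] .
    have sub: "connected_component_set W g \<subseteq> W" by (rule connected_component_subset)
    show "connected_component_set W g \<subseteq> S m" "connected_component_set W g \<subseteq> X"
      "\<And>x. x \<in> connected_component_set W g \<Longrightarrow> h x \<in> Y"
      using sub unfolding W_def by auto
  qed
qed

text \<open>A limit function of the iterates of \<open>h\<close> near \<open>G m\<close> is constant, because by Hurwitz's theorem a
  nonconstant one would force two different iterates to take a common value, and then \<open>G m\<close> would
  meet one of its own preimages.\<close>

lemma preimages_shrink:
  obtains l where "\<And>e. e > 0 \<Longrightarrow> \<exists>M. (h ^^ M) ` G m \<subseteq> ball l e"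
proof -
  obtain T where T: "open T" "connected T" "G m \<subseteq> T" "T \<subseteq> S m" "T \<subseteq> X"
    "\<And>x. x \<in> T \<Longrightarrow> h x \<in> Y" by (rule ex_neighbourhood) blast
  have hk: "(h ^^ Suc k) x \<in> Y" if "x \<in> T" for k x
    using h_power_Y[OF T(6)[OF that]] by (simp add: funpow_swap1)
  have hX: "(h ^^ k) x \<in> X" if "x \<in> T" for k x
    using hk[OF that] Y_sub_X T(5) that by (cases k) auto
  have hol: "(h ^^ k) holomorphic_on T" for k
  proof (induction k)
    case 0 then show ?case by (simp add: id_def[symmetric])
  next
    case (Suc k)
    have "(h ^^ k) ` T \<subseteq> X" using hX by blast
    then show ?case using holomorphic_on_compose_gen[OF Suc h_hol] by (simp add: comp_def)
  qed
  have Rk: "(R ^^ k) ((h ^^ k) x) = x" if "x \<in> T" for k x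
  proof (induction k)
    case (Suc k)
    have "(R ^^ Suc k) ((h ^^ Suc k) x) = (R ^^ k) (R (h ((h ^^ k) x)))"
      by (simp add: funpow_swap1)
    then show ?case using R_h[OF hX[OF that]] Suc by simp
  qed simp
  (* If two values agreed, cancelling the common iterates of h would give a point of S m in Y that
     an iterate of F maps into G m; but such a point is on G m, outside Y. *)
  have distinct: "(h ^^ Suc a) x \<noteq> (h ^^ Suc b) y" if "a < b" "x \<in> T" "y \<in> G m" for a b x y
  proof
    assume eq: "(h ^^ Suc a) x = (h ^^ Suc b) y"
    have yT: "y \<in> T" using T(3) that(3) by blast
    obtain d where d: "b = a + Suc d" using \<open>a < b\<close> by (metis less_iff_Suc_add add_Suc_right)
    have "(h ^^ Suc b) y = (h ^^ Suc a) ((h ^^ Suc d) y)"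
      unfolding d by (metis add_Suc comp_apply funpow_add)
    moreover have "h ((h ^^ d) y) \<in> X" using hX[OF yT, of "Suc d"] by simp
    moreover have cancel: "u = w"
      if "(h ^^ k) u = (h ^^ k) w" "\<And>j. (h ^^ j) u \<in> X" "\<And>j. (h ^^ j) w \<in> X" for k u w
      using that(1)
    proof (induction k)
      case (Suc k)
      then have "R (h ((h ^^ k) u)) = R (h ((h ^^ k) w))" by simp
      then show ?case using R_h that(2,3) Suc.IH by simp
    qed simp
    have "(h ^^ j) ((h ^^ Suc d) y) \<in> X" for j
      using hX[OF yT, of "j + Suc d"] by (metis comp_apply funpow_add)
    ultimately have x: "x = (h ^^ Suc d) y"
      using cancel[of "Suc a" x "(h ^^ Suc d) y"] eq hX[OF that(2)] by simp
    have "(R ^^ Suc d) x = y" unfolding x by (rule Rk[OF yT])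
    then have Fx: "(F ^^ (Suc s * Suc d)) x = y" unfolding R_power .
    have xS: "x \<in> S m" using T(4) that(2) by blast
    have "y \<in> S (m + Suc s * Suc d) \<inter> S m"
      using S_iter[OF xS, of "Suc s * Suc d"] Fx G_sub[of m] that(3) by auto
    then have "(m + Suc s * Suc d) mod p = m mod p" using S_disj by blast
    then have "x \<in> G m" using iter_into_G[OF xS] Fx that(3) by metis
    then show False using G_not_Y hk[OF yT, of d] x by blast
  qed
  have bnd: "\<exists>B. \<forall>g \<in> range (\<lambda>k. h ^^ Suc k). \<forall>z \<in> K. norm (g z) \<le> B" if "compact K" "K \<subseteq> T" for K
  proof -
    obtain B where B: "\<And>z. z \<in> Y \<Longrightarrow> norm z \<le> B"
      using bounded_subset[OF jordan_curveD(7)[OF G_jordan, of m], of Y] unfolding Y_def bounded_iff by blast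
    show ?thesis
    proof (intro exI ballI)
      fix g z assume "g \<in> range (\<lambda>k. h ^^ Suc k)" "z \<in> K"
      then obtain k where "g = h ^^ Suc k" by blast
      moreover have "z \<in> T" using \<open>z \<in> K\<close> \<open>K \<subseteq> T\<close> by blast
      ultimately show "norm (g z) \<le> B" using B[OF hk[of z k]] by (simp only:)
    qed
  qed
  have hol': "f holomorphic_on T" if "f \<in> range (\<lambda>k. h ^^ Suc k)" for f
  proof -
    obtain k where "f = h ^^ Suc k" using \<open>f \<in> _\<close> by (rule rangeE)
    then show ?thesis using hol[of "Suc k"] by (simp only:)
  qed
  obtain g r where g: "g holomorphic_on T" "strict_mono (r :: nat \<Rightarrow> nat)"
    "\<And>K. compact K \<Longrightarrow> K \<subseteq> T \<Longrightarrow> uniform_limit K ((\<lambda>k. h ^^ Suc k) \<circ> r) g sequentially"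
  proof (rule Montel[of T "range (\<lambda>k. h ^^ Suc k)" "\<lambda>k. h ^^ Suc k"])
    fix g and r :: "nat \<Rightarrow> nat"
    assume limit: "g holomorphic_on T" "strict_mono r"
      "\<And>K. compact K \<Longrightarrow> K \<subseteq> T \<Longrightarrow> uniform_limit K ((\<lambda>k. h ^^ Suc k) \<circ> r) g sequentially"
    show thesis by (rule that[OF limit])
  qed (use T(1) hol' bnd in \<open>simp_all only: order_refl\<close>)
  obtain y where y: "y \<in> G m" using jordan_curveD(3)[OF G_jordan] by blast
  then have yT: "y \<in> T" using T(3) by blast
  have "g constant_on T"
  proof (rule ccontr)
    assume nc: "\<not> g constant_on T"
    (* Compare each member of the subsequence with the value at y of the next one: these functions have
       no zeros, while their limit vanishes at y. *)
    let ?H = "\<lambda>n z. (h ^^ Suc (r n)) z - (h ^^ Suc (r (Suc n))) y"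
    have "g y - g y \<noteq> 0"
    proof (rule Hurwitz_no_zeros[OF T(1,2), of ?H "\<lambda>z. g z - g y"])
      show "?H n holomorphic_on T" for n
        by (intro holomorphic_on_diff hol holomorphic_on_const)
      show "(\<lambda>z. g z - g y) holomorphic_on T" using g(1) by (intro holomorphic_intros)
      show "uniform_limit K ?H (\<lambda>z. g z - g y) sequentially" if K: "compact K" "K \<subseteq> T" for K
      proof (rule uniform_limit_minus)
        show "uniform_limit K (\<lambda>n z. (h ^^ Suc (r n)) z) g sequentially"
          using g(3)[OF K] by (simp only: comp_def)
        have "uniform_limit {y} ((\<lambda>k. h ^^ Suc k) \<circ> r) g sequentially" using g(3)[of "{y}"] yT by simp
        from tendsto_uniform_limitI[OF this, of y]
        have "(\<lambda>n. (h ^^ Suc (r n)) y) \<longlonglongrightarrow> g y" by (simp only: comp_def singletonI)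
        then have "(\<lambda>n. (h ^^ Suc (r (Suc n))) y) \<longlonglongrightarrow> g y" by (rule LIMSEQ_Suc)
        then show "uniform_limit K (\<lambda>n z. (h ^^ Suc (r (Suc n))) y) (\<lambda>z. g y) sequentially"
          unfolding uniform_limit_iff tendsto_iff by (auto elim: eventually_mono)
      qed
      show "\<not> (\<lambda>z. g z - g y) constant_on T"
      proof
        assume "(\<lambda>z. g z - g y) constant_on T"
        then obtain w where "\<forall>z\<in>T. g z - g y = w" unfolding constant_on_def by blast
        then have "\<forall>z\<in>T. g z = w + g y" by (simp add: algebra_simps)
        then show False using nc unfolding constant_on_def by blast
      qed
      show "?H n z \<noteq> 0" if "z \<in> T" for n z
        using distinct[OF strict_monoD[OF g(2), of n "Suc n"] that y] by simp
    qed (rule yT)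
    then show False by simp
  qed
  then obtain l where l: "\<And>z. z \<in> T \<Longrightarrow> g z = l" unfolding constant_on_def by blast
  show ?thesis
  proof (rule that[of l])
    fix e :: real assume "e > 0"
    then have "\<forall>\<^sub>F n in sequentially. \<forall>z\<in>G m. dist (((\<lambda>k. h ^^ Suc k) \<circ> r) n z) (g z) < e"
      using g(3)[OF jordan_curveD(1)[OF G_jordan] T(3)] unfolding uniform_limit_iff by blast
    then obtain n where n: "\<forall>z\<in>G m. dist ((h ^^ Suc (r n)) z) (g z) < e"
      unfolding eventually_sequentially comp_def by blast
    have "(h ^^ Suc (r n)) ` G m \<subseteq> ball l e"
    proof
      fix w assume "w \<in> (h ^^ Suc (r n)) ` G m"
      then obtain z where "z \<in> G m" "w = (h ^^ Suc (r n)) z" by blast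
      then show "w \<in> ball l e" using n l T(3) by (metis dist_commute mem_ball subsetD)
    qed
    then show "\<exists>M. (h ^^ M) ` G m \<subseteq> ball l e" by blast
  qed
qed

definition pullback :: "nat \<Rightarrow> complex set" where "pullback t = (h ^^ t) ` G m"

lemma pullback_0: "pullback 0 = G m" unfolding pullback_def by simp

lemma pullback_Suc: "pullback (Suc t) = h ` pullback t" unfolding pullback_def by (simp add: image_comp)

lemma pullback_Y: "pullback (Suc t) \<subseteq> Y"
  by (induction t) (auto simp: pullback_Suc pullback_0 h_Y)

lemma pullback_X: "pullback t \<subseteq> X"
  using pullback_Y Y_sub_X G_sub_X pullback_0 by (cases t) auto

lemma R_pullback: "R ` pullback (Suc t) = pullback t"
  unfolding pullback_Suc image_image using R_h pullback_X[of t] by force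

lemma pullback_jordan: "jordan_curve (pullback t)"
proof (induction t)
  case (Suc t)
  have "continuous_on (pullback t) h"
    using holomorphic_on_imp_continuous_on[OF h_hol] pullback_X continuous_on_subset by blast
  moreover have "inj_on h (pullback t)" using R_h pullback_X[of t] by (metis inj_onI subsetD)
  ultimately show ?case unfolding pullback_Suc by (intro jordan_curve_image[OF Suc])
qed (simp add: pullback_0 G_jordan)

lemma filled_pullback: "filled (pullback (Suc t)) \<subseteq> D m" "outside (G m) \<subseteq> outside (pullback t)"
proof -
  have sub: "pullback (Suc t) \<subseteq> D m" for t using pullback_Y[of t] unfolding Y_def by blast
  show "filled (pullback (Suc t)) \<subseteq> D m" using jordan_inside_nested(1)[OF G_jordan pullback_jordan sub] .
  show "outside (G m) \<subseteq> outside (pullback t)"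
    using jordan_inside_nested(2)[OF G_jordan pullback_jordan sub] pullback_0 by (cases t) auto
qed

lemma P0_pullback: "P0 \<notin> pullback (Suc t)"
  unfolding pullback_Suc using h_in pullback_X[of t] by blast

text \<open>The point \<open>P0\<close> cannot be enclosed, since then \<open>R\<close> would map the interior onto an exterior domain
  that contains \<open>R ` D (q N)\<close>, and \<open>D (q N)\<close> would be enclosed as well.  So \<open>R\<close> maps the interior onto
  the interior of the image curve, and \<open>R_avoids\<close> applies to it.\<close>

lemma pullback_step:
  assumes avoid: "\<And>i. i \<le> N \<Longrightarrow> inside (pullback (Suc t)) \<inter> Dbar (q i) = {}" and i: "i \<le> N"
  shows "inside (pullback t) \<inter> Dbar (q i) = {}"
proof -
  have sub: "filled (pullback (Suc t)) \<subseteq> Dbar m" using filled_pullback(1) D_Dbar(1) by blast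
  have "P0 \<notin> inside (pullback (Suc t))"
  proof
    assume P: "P0 \<in> inside (pullback (Suc t))"
    note out = R_image_curve_pole[OF pullback_jordan sub P, unfolded R_pullback]
    obtain x where x: "x \<in> D (q N)" using jordan_curveD(4)[OF G_jordan] by blast
    then have xN: "x \<in> Dbar (q N)" using D_Dbar(1) by blast
    have "R x \<in> Dbar (q (Suc N))" using R_Dbar_q_last[of N] xN by blast
    then have "R x \<in> outside (G m)" using last_leaves unfolding filled_compl_outside by blast
    then have "R x \<in> R ` (inside (pullback (Suc t)) - {P0})" unfolding out using filled_pullback(2) by blast
    then obtain y where y: "y \<in> inside (pullback (Suc t)) - {P0}" "R x = R y" by blast
    have "y \<in> Dbar m - {P0}" using y sub filled_props(4)[OF pullback_jordan, of "Suc t"] by blast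
    moreover have "x \<in> Dbar m - {P0}" using xN x pole_not_in_last Dbar_q_m[of N] by blast
    ultimately have "x = y" using inj_onD[OF R_inj y(2)] by blast
    then show False using avoid[of N] xN y(1) by blast
  qed
  then have P: "P0 \<notin> filled (pullback (Suc t))" using P0_pullback unfolding filled_def by blast
  have eq: "R ` inside (pullback (Suc t)) = inside (pullback t)"
    using R_image_curve(1)[OF pullback_jordan sub P] R_pullback by simp
  have "inside (pullback (Suc t)) \<subseteq> D m - {P0}"
    using filled_pullback(1)[of t] P filled_props(4)[OF pullback_jordan, of "Suc t"] by blast
  from R_avoids[OF this avoid i] show ?thesis unfolding eq by simp
qed

text \<open>A small pullback encloses no disc \<open>D (q i)\<close>, and by the previous lemma neither does the zeroth one,
  which is \<open>G m\<close> and encloses all of them.\<close>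

lemma backward_orbit_impossible: False
proof -
  obtain l where l: "\<And>e. e > 0 \<Longrightarrow> \<exists>M. pullback M \<subseteq> ball l e"
    using preimages_shrink unfolding pullback_def by metis
  have "\<exists>a. a \<in> D (q i) \<and> a \<noteq> l" for i
  proof (rule ccontr)
    assume "\<not> ?thesis"
    then have "D (q i) = {l}" using jordan_curveD(4)[OF G_jordan, of "q i"] by blast
    then show False using jordan_curveD(5)[OF G_jordan, of "q i"] not_open_singleton by metis
  qed
  then obtain a where a: "\<And>i. a i \<in> D (q i)" "\<And>i. a i \<noteq> l" by metis
  (* The radius e is so small that none of the discs D (q i) fits into the ball around l. *)
  define e where "e = Min ((\<lambda>i. dist l (a i)) ` {..N})"
  have e: "e > 0" unfolding e_def using a(2) by (subst Min_gr_iff) (auto simp: eq_commute)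
  have ea: "a i \<notin> ball l e" if "i \<le> N" for i
  proof -
    have "e \<le> dist l (a i)" unfolding e_def using that by (intro Min_le) auto
    then show ?thesis by simp
  qed
  obtain M where M: "pullback M \<subseteq> ball l e" using l[OF e] by blast
  have in_ball: "inside (pullback M) \<subseteq> ball l e"
    using outside_subset_convex[OF convex_ball M] jordan_curveD(12)[OF pullback_jordan, of M] by blast
  have small: "inside (pullback M) \<inter> Dbar (q i) = {}" if i: "i \<le> N" for i
  proof -
    have "Dbar (q i) \<inter> pullback M = {}"
    proof (cases M)
      case 0 then show ?thesis using pullback_0 Dbar_q[OF i] inside_no_overlap[of "G m"] by blast
    next
      case (Suc t) then show ?thesis using pullback_Y[of t] Y_avoids[OF i] by blast
    qed
    then have "Dbar (q i) \<subseteq> inside (pullback M) \<or> Dbar (q i) \<subseteq> outside (pullback M)"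
      using connected_avoiding_jordan[OF pullback_jordan filled_props(2)[OF G_jordan]] by blast
    moreover have "\<not> Dbar (q i) \<subseteq> inside (pullback M)"
      using in_ball ea[OF i] a(1)[of i] D_Dbar(1)[of "q i"] by blast
    ultimately show ?thesis using jordan_curveD(12)[OF pullback_jordan, of M] by blast
  qed
  have "\<forall>i\<le>N. inside (pullback t) \<inter> Dbar (q i) = {}" if "t \<le> M" for t
    using that
  proof (induction t rule: inc_induct)
    case base then show ?case using small by blast
  next
    case (step t) then show ?case using pullback_step[of t] by blast
  qed
  from this[of 0] have "D m \<inter> Dbar (q 0) = {}" using pullback_0 by simp
  then show False using Dbar_q0 D_Dbar(1)[of "q 0"] jordan_curveD(4)[OF G_jordan, of "q 0"] by blast
qed

end

lemma (in curve_cycle) curve_cycle_impossible: False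
proof -
  obtain m where m: "v \<in> D m" "\<And>k. v \<in> D k \<Longrightarrow> k mod p \<noteq> m mod p \<Longrightarrow> Dbar k \<subseteq> D m"
    using ex_outermost by blast
  obtain i where i: "D i \<inter> Pol \<noteq> {}" using ex_pole by blast
  (* Indices only increase, so i is reached from m by going around the cycle. *)
  have "m + (i + (p - 1) * m) = i + p * m" using p_pos by (cases p) auto
  then have "(m + (i + (p - 1) * m)) mod p = i mod p" by (simp only: mod_mult_self2)
  then have ex: "\<exists>s. D (m + s) \<inter> Pol \<noteq> {}" using i G_mod by metis
  define s where "s = (LEAST s. D (m + s) \<inter> Pol \<noteq> {})"
  have s: "D (m + s) \<inter> Pol \<noteq> {}" "\<And>j. j < s \<Longrightarrow> D (m + j) \<inter> Pol = {}"
    unfolding s_def using LeastI_ex[OF ex] not_less_Least by blast+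
  have "(F ^^ s) ` D m = D (m + s)" by (rule iterate_D_no_pole(3)[OF s(2)])
  moreover obtain w where w: "w \<in> D (m + s)" "w \<in> Pol" using s(1) by blast
  ultimately obtain P0 where P0: "P0 \<in> D m" "(F ^^ s) P0 \<in> Pol" by (metis imageE)
  interpret ret: outermost_return F Pol v p S G m s P0
    by unfold_locales (fact m s P0)+
  obtain h where h: "h holomorphic_on ret.X" "\<And>x. x \<in> ret.X \<Longrightarrow> h x \<in> D m - {P0}"
    "\<And>x. x \<in> ret.X \<Longrightarrow> ret.R (h x) = x" using ret.ex_inverse by blast
  interpret backward_orbit F Pol v p S G m s P0 h
    by unfold_locales (fact h)+
  show False by (rule backward_orbit_impossible)
qed

section \<open>Injectivity of the tangent of the square on filled curves\<close>

definition tsq :: "complex \<Rightarrow> complex \<Rightarrow> complex" where "tsq c z = c + tan (z\<^sup>2)"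

definition tsq_poles :: "complex set" where "tsq_poles = {z. cos (z\<^sup>2) = 0}"

lemma tan_eq_imp:
  fixes z w :: complex
  assumes "cos z \<noteq> 0" "cos w \<noteq> 0" "tan z = tan w"
  shows "\<exists>k::int. z = w + of_int k * of_real pi"
proof -
  have "sin z * cos w - cos z * sin w = 0" using assms by (simp add: tan_def field_simps)
  then have "sin (z - w) = 0" by (simp add: sin_diff)
  then obtain k :: int where "z - w = of_real (k * pi)" using sin_eq_0 by blast
  then show ?thesis by (intro exI[of _ k]) (simp add: algebra_simps)
qed

lemma cos_eq_0_imp:
  fixes z w :: complex
  assumes "cos z = 0" "cos w = 0"
  shows "\<exists>k::int. z = w + of_int k * of_real pi"
proof -
  have "sin (z - w) = 0" using assms by (simp add: sin_diff)
  then obtain k :: int where "z - w = of_real (k * pi)" using sin_eq_0 by blast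
  then show ?thesis by (intro exI[of _ k]) (simp add: algebra_simps)
qed

lemma tan_ne_ii:
  assumes "cos z \<noteq> 0" shows "tan z \<noteq> \<i>"
proof
  assume "tan z = \<i>"
  then have "sin z = \<i> * cos z" using assms by (simp add: tan_def field_simps)
  then have "(sin z)\<^sup>2 + (cos z)\<^sup>2 = 0" by (simp add: power_mult_distrib)
  then show False by simp
qed

lemma tsq_holomorphic: "tsq c holomorphic_on - tsq_poles"
proof -
  have "(\<lambda>z. c + sin (z\<^sup>2) / cos (z\<^sup>2)) holomorphic_on - tsq_poles"
    unfolding tsq_poles_def by (intro holomorphic_intros) auto
  then show ?thesis unfolding tsq_def tan_def .
qed

lemma tsq_omits: "z \<notin> tsq_poles \<Longrightarrow> tsq c z \<noteq> c + \<i>"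
  unfolding tsq_def tsq_poles_def using tan_ne_ii by auto

lemma tsq_at_pole:
  assumes "P \<in> tsq_poles" shows "filterlim (tsq c) at_infinity (at P)"
proof -
  have P: "cos (P\<^sup>2) = 0" using assms unfolding tsq_poles_def by simp
  have hol: "(\<lambda>z::complex. cos (z\<^sup>2)) holomorphic_on UNIV" by (intro holomorphic_intros)
  obtain r where r: "0 < r" "\<And>z. z \<in> ball P r - {P} \<Longrightarrow> cos (z\<^sup>2) \<noteq> 0"
    using isolated_zeros[OF hol open_UNIV connected_UNIV _ P, of 0]
    by (metis UNIV_I cos_zero one_neq_zero power_zero_numeral)
  have "(sin (P\<^sup>2))\<^sup>2 = 1" using sin_cos_squared_add[of "P\<^sup>2"] P by simp
  then have s: "sin (P\<^sup>2) \<noteq> 0" by auto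
  have "\<forall>\<^sub>F z in at P. z \<in> ball P r - {P}" using eventually_at_in_open[of "ball P r" P] r(1) by simp
  then have "\<forall>\<^sub>F z in at P. cos (z\<^sup>2) \<noteq> 0" by eventually_elim (use r(2) in blast)
  moreover have "((\<lambda>z. cos (z\<^sup>2)) \<longlongrightarrow> cos (P\<^sup>2)) (at P)" by (intro tendsto_intros)
  ultimately have "filterlim (\<lambda>z. cos (z\<^sup>2)) (at 0) (at P)" using P by (simp add: filterlim_at)
  moreover have "((\<lambda>z. sin (z\<^sup>2)) \<longlongrightarrow> sin (P\<^sup>2)) (at P)" by (intro tendsto_intros)
  ultimately have "filterlim (\<lambda>z. sin (z\<^sup>2) / cos (z\<^sup>2)) at_infinity (at P)"
    using filterlim_divide_at_infinity s by blast
  then have "filterlim (\<lambda>z. c + sin (z\<^sup>2) / cos (z\<^sup>2)) at_infinity (at P)"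
    by (rule tendsto_add_filterlim_at_infinity[OF tendsto_const])
  then show ?thesis unfolding tsq_def[abs_def] tan_def .
qed

lemma image_filled:
  fixes f :: "complex \<Rightarrow> complex"
  assumes "jordan_curve G" "continuous_on (filled G) f" "inj_on f (filled G)"
  shows "f ` filled G = filled (f ` G)"
  unfolding filled_def image_Un image_inside_jordan[OF assms, symmetric] ..

text \<open>A Jordan curve disjoint from its reflection at the origin cannot surround its reflection, since one
  filling would lie strictly inside the other, and by symmetry also the other way round.\<close>

lemma filled_disjoint_uminus:
  assumes G: "jordan_curve G" and dis: "G \<inter> uminus ` G = {}"
  shows "filled G \<inter> uminus ` filled G = {}"
proof -
  have ci: "continuous_on A uminus" "inj_on uminus A" for A :: "complex set"
    by (auto intro: continuous_intros)
  have G': "jordan_curve (uminus ` G)" using jordan_curve_image[OF G ci] .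
  have f: "uminus ` filled G = filled (uminus ` G)" using image_filled[OF G ci] .
  have i: "uminus ` inside G = inside (uminus ` G)" using image_inside_jordan[OF G ci] .
  have key: "\<not> uminus ` filled G \<subseteq> inside G"
  proof
    assume sub: "uminus ` filled G \<subseteq> inside G"
    then have "uminus ` uminus ` filled G \<subseteq> uminus ` filled G" using filled_props(4)[OF G] by blast
    then have "filled G \<subseteq> uminus ` filled G" by (simp add: image_comp)
    then show False using sub filled_subset_inside_irrefl[OF G] by blast
  qed
  moreover have "\<not> filled G \<subseteq> inside (uminus ` G)"
  proof
    assume "filled G \<subseteq> inside (uminus ` G)"
    then have "uminus ` filled G \<subseteq> uminus ` uminus ` inside G" unfolding i[symmetric] by blast
    then show False using key by (simp add: image_comp)
  qed
  ultimately show ?thesis using jordan_trichotomy[OF G G' dis] unfolding f by blast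
qed

lemma bounded_translation_invariant:
  fixes t :: complex
  assumes "bounded K" "K \<noteq> {}" "\<And>z. z \<in> K \<Longrightarrow> z + t \<in> K"
  shows "t = 0"
proof (rule ccontr)
  assume "t \<noteq> 0"
  obtain z where z: "z \<in> K" using assms(2) by blast
  obtain B where B: "\<And>x. x \<in> K \<Longrightarrow> norm x \<le> B" using assms(1) unfolding bounded_iff by blast
  have it: "z + of_nat n * t \<in> K" for n
  proof (induction n)
    case (Suc n)
    then show ?case using assms(3)[OF Suc] by (simp add: algebra_simps)
  qed (simp add: z)
  obtain n :: nat where n: "2 * B < of_nat n * norm t"
    using reals_Archimedean3[of "norm t"] \<open>t \<noteq> 0\<close> by auto
  have "of_nat n * norm t = norm ((z + of_nat n * t) - z)" by (simp add: norm_mult)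
  also have "\<dots> \<le> norm (z + of_nat n * t) + norm z" by (rule norm_triangle_ineq4)
  also have "\<dots> \<le> 2 * B" using B[OF it[of n]] B[OF z] by simp
  finally show False using n by simp
qed

lemma filled_disjoint_translate:
  assumes Q: "jordan_curve Q" and t: "t \<noteq> 0" and dis: "Q \<inter> (\<lambda>z. z + t) ` Q = {}"
  shows "filled Q \<inter> (\<lambda>z. z + t) ` filled Q = {}"
proof -
  let ?T = "\<lambda>z::complex. z + t"
  have ci: "continuous_on A ?T" "inj_on ?T A" for A :: "complex set"
    by (auto intro: continuous_intros)
  have Q': "jordan_curve (?T ` Q)" using jordan_curve_image[OF Q ci] .
  have f: "?T ` filled Q = filled (?T ` Q)" using image_filled[OF Q ci] .
  have bd: "bounded (filled Q)" "filled Q \<noteq> {}"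
    using filled_props(1,5)[OF Q] compact_imp_bounded jordan_curveD(3)[OF Q] by auto
  have "\<not> ?T ` filled Q \<subseteq> filled Q"
    using bounded_translation_invariant[OF bd, of t] t by blast
  moreover have "\<not> filled Q \<subseteq> ?T ` filled Q"
  proof
    assume sub: "filled Q \<subseteq> ?T ` filled Q"
    have "z + - t \<in> filled Q" if "z \<in> filled Q" for z using sub that by auto
    then show False using bounded_translation_invariant[OF bd, of "- t"] t by simp
  qed
  ultimately show ?thesis
    using jordan_trichotomy[OF Q Q' dis] filled_props(4)[OF Q] filled_props(4)[OF Q'] unfolding f by blast
qed

text \<open>As \<open>tsq c\<close> is even, injectivity near the curve keeps the curve and its filling away from their
  reflections, and squaring is injective on the filling.  The squared curve is likewise disjoint
  from its translates by nonzero multiples of \<open>pi\<close>, and so is its filling.\<close>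

lemma filled_squares_incongruent:
  assumes S: "open S" "S \<inter> tsq_poles = {}" "inj_on (tsq c) S" and G: "jordan_curve G" "G \<subseteq> S"
    and zw: "z \<in> filled G" "w \<in> filled G" "z\<^sup>2 = w\<^sup>2 + of_int k * of_real pi"
  shows "z = w"
proof -
  (* An even function is not injective near 0. *)
  have zero: "0 \<notin> S"
  proof
    assume "0 \<in> S"
    then obtain e where e: "e > 0" "ball 0 e \<subseteq> S" using S(1) open_contains_ball by blast
    define x where "x = complex_of_real (e / 2)"
    have "x \<in> S" "- x \<in> S" using e unfolding x_def by auto
    moreover have "tsq c x = tsq c (- x)" by (simp add: tsq_def)
    ultimately have "x = - x" using S(3) inj_onD by metis
    then show False using e(1) unfolding x_def by simp
  qed
  have "G \<inter> uminus ` G = {}"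
  proof (rule ccontr)
    assume "\<not> ?thesis"
    then obtain x where x: "x \<in> G" "- x \<in> G" by force
    have "tsq c x = tsq c (- x)" by (simp add: tsq_def)
    then have "x = - x" using x G(2) S(3) by (metis inj_onD subsetD)
    then have "x = 0" by simp
    then show False using x G(2) zero by blast
  qed
  then have dis: "filled G \<inter> uminus ` filled G = {}" using filled_disjoint_uminus[OF G(1)] by blast
  have inj: "inj_on (\<lambda>z. z\<^sup>2) (filled G)"
  proof (rule inj_onI)
    fix x y :: complex assume xy: "x \<in> filled G" "y \<in> filled G" "x\<^sup>2 = y\<^sup>2"
    then have "x = y \<or> x = - y" by (simp add: power2_eq_iff)
    then show "x = y" using xy dis by blast
  qed
  have cont: "continuous_on (filled G) (\<lambda>z. z\<^sup>2)" by (intro continuous_intros)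
  define Q where "Q = (\<lambda>z. z\<^sup>2) ` G"
  have Q: "jordan_curve Q" unfolding Q_def
    using jordan_curve_image[OF G(1)] cont inj filled_props(5)[OF G(1)]
    by (metis (no_types, lifting) continuous_on_subset inj_on_subset)
  have fQ: "filled Q = (\<lambda>z. z\<^sup>2) ` filled G"
    unfolding Q_def using image_filled[OF G(1) cont inj] by simp
  have "k = 0"
  proof (rule ccontr)
    assume k: "k \<noteq> 0"
    let ?t = "of_int k * of_real pi :: complex"
    have "Q \<inter> (\<lambda>z. z + ?t) ` Q = {}"
    proof (rule ccontr)
      assume "\<not> ?thesis"
      then obtain x y where xy: "x \<in> G" "y \<in> G" "x\<^sup>2 = y\<^sup>2 + ?t" unfolding Q_def by auto
      have "cos (x\<^sup>2) \<noteq> 0" "cos (y\<^sup>2) \<noteq> 0" using xy G(2) S(2) unfolding tsq_poles_def by blast+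
      moreover have "sin (x\<^sup>2 - y\<^sup>2) = 0" using xy(3) sin_eq_0[of ?t] by auto
      ultimately have "tan (x\<^sup>2) = tan (y\<^sup>2)" by (simp add: sin_diff tan_def field_simps)
      then have "x = y" using xy G(2) S(3) unfolding tsq_def by (metis inj_onD subsetD)
      then show False using xy(3) k by simp
    qed
    then have "filled Q \<inter> (\<lambda>z. z + ?t) ` filled Q = {}"
      using filled_disjoint_translate[OF Q] k by simp
    moreover have "z\<^sup>2 \<in> filled Q" "w\<^sup>2 \<in> filled Q" unfolding fQ using zw(1,2) by blast+
    ultimately show False using zw(3) by blast
  qed
  then show ?thesis using zw inj by (simp add: inj_on_def)
qed

lemma tsq_inj_filled:
  assumes "open S" "S \<inter> tsq_poles = {}" "inj_on (tsq c) S" "jordan_curve G" "G \<subseteq> S"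
  shows "inj_on (tsq c) (filled G - tsq_poles)"
    "\<And>P P'. P \<in> tsq_poles \<inter> filled G \<Longrightarrow> P' \<in> tsq_poles \<inter> filled G \<Longrightarrow> P = P'"
proof -
  note key = filled_squares_incongruent[OF assms]
  show "inj_on (tsq c) (filled G - tsq_poles)"
  proof (rule inj_onI)
    fix x y assume xy: "x \<in> filled G - tsq_poles" "y \<in> filled G - tsq_poles" "tsq c x = tsq c y"
    then have "cos (x\<^sup>2) \<noteq> 0" "cos (y\<^sup>2) \<noteq> 0" "tan (x\<^sup>2) = tan (y\<^sup>2)"
      unfolding tsq_poles_def tsq_def by auto
    then show "x = y" using tan_eq_imp[of "x\<^sup>2" "y\<^sup>2"] key[of x y] xy by blast
  qed
  show "P = P'" if "P \<in> tsq_poles \<inter> filled G" "P' \<in> tsq_poles \<inter> filled G" for P P'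
    using cos_eq_0_imp[of "P\<^sup>2" "P'\<^sup>2"] key[of P P'] that unfolding tsq_poles_def by blast
qed

section \<open>From Herman rings to invariant curves\<close>

lemma tan_square_map_finite: "z \<notin> tsq_poles \<Longrightarrow> tan_square_map c z = Finite (tsq c z)"
  by (simp add: tan_square_map_def tsq_def tsq_poles_def)

lemma iterate_tan_square_map:
  assumes "\<And>k. k < n \<Longrightarrow> (tsq c ^^ k) z \<notin> tsq_poles"
  shows "iterate (tan_square_map c) n z = Finite ((tsq c ^^ n) z)"
  using assms
proof (induction n)
  case (Suc n)
  then have "iterate (tan_square_map c) n z = Finite ((tsq c ^^ n) z)" "(tsq c ^^ n) z \<notin> tsq_poles"
    by auto
  then show ?case by (simp add: tan_square_map_finite)
qed simp

lemma continuous_on_Finite: "continuous_on A Finite"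
proof -
  have nz: "(cmod z)\<^sup>2 + 1 \<noteq> 0" for z 
    by (metis add.commute sum_power2_eq_zero_iff power_one zero_neq_one)
  have "continuous_on A (\<lambda>z. stereographic (Finite z))"
    unfolding stereographic.simps using nz by (intro continuous_intros) auto
  then show ?thesis unfolding continuous_on_iff dist_riemann_sphere_def .
qed

lemma uniform_limit_Finite:
  assumes lim: "uniform_limit K f g sequentially" and bd: "\<And>n z. z \<in> K \<Longrightarrow> norm (f n z) \<le> B"
  shows "uniform_limit K (\<lambda>n z. Finite (f n z)) (\<lambda>z. Finite (g z)) sequentially"
proof (rule uniform_limitI)
  fix e :: real assume e: "e > 0"
  have "uniformly_continuous_on (cball 0 B) Finite"
    by (rule compact_uniformly_continuous[OF continuous_on_Finite compact_cball])
  then obtain d where d: "d > 0" "\<And>x y. x \<in> cball 0 B \<Longrightarrow> y \<in> cball 0 B \<Longrightarrow> dist y x < d \<Longrightarrow>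
      dist (Finite y) (Finite x) < e"
    unfolding uniformly_continuous_on_def using e by metis
  have gB: "g z \<in> cball 0 B" if "z \<in> K" for z
    using tendsto_uniform_limitI[OF lim that] bd[OF that]
    by (intro Lim_in_closed_set[of "cball 0 B" "\<lambda>n. f n z" sequentially]) auto
  have "\<forall>\<^sub>F n in sequentially. \<forall>z\<in>K. dist (f n z) (g z) < d"
    using lim d(1) unfolding uniform_limit_iff by blast
  then show "\<forall>\<^sub>F n in sequentially. \<forall>z\<in>K. dist (Finite (f n z)) (Finite (g z)) < e"
    by eventually_elim (use d(2) gB bd in auto)
qed

text \<open>Montel's theorem in the form in which it enters here: where all iterates are defined and uniformly
  bounded they form a normal family, also for the chordal metric.\<close>

lemma bounded_orbits_fatou:
  assumes U: "open U" and np: "\<And>n z. z \<in> U \<Longrightarrow> (tsq c ^^ n) z \<notin> tsq_poles"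
    and bd: "bounded (\<Union>n. (tsq c ^^ n) ` U)"
  shows "U \<subseteq> fatou_set (tan_square_map c)"
proof -
  let ?f = "tan_square_map c"
  have it: "iterate ?f n z = Finite ((tsq c ^^ n) z)" if "z \<in> U" for n z
    using iterate_tan_square_map np[OF that] by blast
  obtain B where B: "\<And>n z. z \<in> U \<Longrightarrow> norm ((tsq c ^^ n) z) \<le> B"
    using bd unfolding bounded_iff by blast
  have hol: "(tsq c ^^ n) holomorphic_on U" for n
  proof (induction n)
    case 0 then show ?case by (simp add: id_def[symmetric])
  next
    case (Suc n)
    have "(tsq c ^^ n) ` U \<subseteq> - tsq_poles" using np by blast
    then show ?case using holomorphic_on_compose_gen[OF Suc tsq_holomorphic] by (simp add: comp_def)
  qed
  have "normal_family U (range (iterate ?f))"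
    unfolding normal_family_def
  proof (intro allI impI)
    fix s :: "nat \<Rightarrow> complex \<Rightarrow> riemann_sphere" assume "range s \<subseteq> range (iterate ?f)"
    then have "\<forall>n. \<exists>k. s n = iterate ?f k" by blast
    then obtain k where k: "\<And>n. s n = iterate ?f (k n)" by metis
    obtain g r where g: "strict_mono (r :: nat \<Rightarrow> nat)"
      "\<And>K. compact K \<Longrightarrow> K \<subseteq> U \<Longrightarrow> uniform_limit K ((\<lambda>n. tsq c ^^ k n) \<circ> r) g sequentially"
    proof (rule Montel[of U "range (\<lambda>n. tsq c ^^ n)" "\<lambda>n. tsq c ^^ k n"])
      fix g and r :: "nat \<Rightarrow> nat"
      assume limit: "strict_mono r"
        "\<And>K. compact K \<Longrightarrow> K \<subseteq> U \<Longrightarrow> uniform_limit K ((\<lambda>n. tsq c ^^ k n) \<circ> r) g sequentially"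
      show thesis by (rule that[OF limit])
    next
      fix K assume "K \<subseteq> U"
      then show "\<exists>B. \<forall>h\<in>range (\<lambda>n. tsq c ^^ n). \<forall>z\<in>K. norm (h z) \<le> B" using B by blast
    qed (use U hol in auto)
    have "uniform_limit K (\<lambda>n. s (r n)) (\<lambda>z. Finite (g z)) sequentially" if K: "compact K" "K \<subseteq> U" for K
    proof -
      have "uniform_limit K (\<lambda>n. tsq c ^^ k (r n)) g sequentially"
        using g(2)[OF K] by (simp only: comp_def)
      then have "uniform_limit K (\<lambda>n z. Finite ((tsq c ^^ k (r n)) z)) (\<lambda>z. Finite (g z)) sequentially"
        by (rule uniform_limit_Finite) (use B K(2) in blast)
      then show ?thesis
        by (rule uniform_limit_cong'[THEN iffD1, rotated 2]) (use k it K(2) in auto)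
    qed
    then show "\<exists>r g. strict_mono r \<and> (\<forall>K. compact K \<and> K \<subseteq> U \<longrightarrow> uniform_limit K (\<lambda>n. s (r n)) g sequentially)"
      using g(1) by blast
  qed
  then have "\<exists>V. open V \<and> z \<in> V \<and> (\<forall>n. \<forall>w\<in>V. iterate_defined ?f n w) \<and> normal_family V (range (iterate ?f))"
    if "z \<in> U" for z
    using U that it unfolding iterate_defined_def by (intro exI[of _ U]) auto
  then show ?thesis unfolding fatou_set_def by blast
qed

lemma open_fatou_set: "open (fatou_set f)"
proof -
  have "fatou_set f = \<Union>{U. open U \<and> (\<forall>n. \<forall>w\<in>U. iterate_defined f n w) \<and> normal_family U (range (iterate f))}"
    unfolding fatou_set_def by blast
  then show ?thesis by auto
qed

text \<open>The curves are the images of one round circle of the rotation in the ring with index \<open>0\<close>.\<close>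

lemma herman_ring_cycle_curves:
  assumes "herman_ring_cycle (tan_square_map c) p S0"
  shows "\<exists>S G. curve_cycle (tsq c) tsq_poles (c + \<i>) p S G"
proof -
  let ?f = "tan_square_map c" and ?F = "tsq c"
  define S where "S i = S0 (i mod p)" for i
  have p: "p > 0" and injS: "inj_on S0 {..<p}"
    and comp0: "\<And>i. i < p \<Longrightarrow> S0 i \<in> components (fatou_set ?f)"
    and step0: "\<And>i. i < p \<Longrightarrow> ?f ` S0 i \<subseteq> Finite ` S0 (Suc i mod p)"
    and rot0: "\<And>i. i < p \<Longrightarrow> conjugate_to_irrational_rotation (iterate ?f p) (S0 i)"
    using assms unfolding herman_ring_cycle_def fatou_cycle_def fatou_component_def by auto
  have comp: "S i \<in> components (fatou_set ?f)" for i unfolding S_def using comp0 p by simp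
  have np: "z \<notin> tsq_poles" and step: "?F z \<in> S (Suc i)" if "z \<in> S i" for z i
  proof -
    have "?f z \<in> Finite ` S (Suc i)"
      using step0[of "i mod p"] that p unfolding S_def by (auto simp: mod_Suc_eq)
    then have "cos (z\<^sup>2) \<noteq> 0 \<and> ?F z \<in> S (Suc i)"
      unfolding tan_square_map_def tsq_def by (auto split: if_splits)
    then show "z \<notin> tsq_poles" "?F z \<in> S (Suc i)" unfolding tsq_poles_def by auto
  qed
  have iter_S: "(?F ^^ n) z \<in> S (i + n)" if "z \<in> S i" for n i z
    by (induction n) (use that step in auto)
  have it: "iterate ?f n z = Finite ((?F ^^ n) z)" if "z \<in> S i" for n i z
    using iterate_tan_square_map np[OF iter_S[OF that]] by blast
  have S_open: "open (S i)" for i using open_components[OF open_fatou_set comp] .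
  have per: "S (i + p) = S i" for i unfolding S_def by simp
  have disj: "S i \<inter> S j = {}" if "i mod p \<noteq> j mod p" for i j
  proof -
    have "S i \<noteq> S j" unfolding S_def using inj_onD[OF injS, of "i mod p" "j mod p"] that p by auto
    then show ?thesis using components_nonoverlap[OF comp comp] by blast
  qed
  have rot: "\<exists>a b \<phi> \<psi> u. 0 < a \<and> a < b \<and> homeomorphism (S i) (round_annulus a b) \<phi> \<psi> \<and>
      norm u = 1 \<and> (\<forall>z\<in>S i. (?F ^^ p) z \<in> S i \<and> \<phi> ((?F ^^ p) z) = u * \<phi> z)" for i
  proof -
    have "conjugate_to_irrational_rotation (iterate ?f p) (S i)" unfolding S_def using rot0 p by simp
    then obtain a b \<phi> \<psi> \<theta> where h: "0 < a" "a < b" "homeomorphism (S i) (round_annulus a b) \<phi> \<psi>"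
      "\<And>z. z \<in> S i \<Longrightarrow> \<exists>w\<in>S i. iterate ?f p z = Finite w \<and> \<phi> w = cis (2 * pi * \<theta>) * \<phi> z"
      unfolding conjugate_to_irrational_rotation_def by blast
    have "(?F ^^ p) z \<in> S i \<and> \<phi> ((?F ^^ p) z) = cis (2 * pi * \<theta>) * \<phi> z" if "z \<in> S i" for z
      using h(4)[OF that] it[OF that, of p] by auto
    then show ?thesis using h(1-3) norm_cis by blast
  qed
  have rot_inj: "inj_on (?F ^^ p) (S i)" and rot_surj: "S i \<subseteq> (?F ^^ p) ` S i" for i
  proof -
    obtain a b \<phi> \<psi> u where h: "homeomorphism (S i) (round_annulus a b) \<phi> \<psi>" "norm u = 1"
      "\<And>z. z \<in> S i \<Longrightarrow> (?F ^^ p) z \<in> S i \<and> \<phi> ((?F ^^ p) z) = u * \<phi> z" using rot[of i] by blast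
    have u: "u \<noteq> 0" using h(2) by auto
    have inj: "inj_on \<phi> (S i)" by (rule inj_on_inverseI[of _ \<psi>]) (rule homeomorphism_apply1[OF h(1)])
    show "inj_on (?F ^^ p) (S i)"
    proof (rule inj_onI)
      fix x y assume xy: "x \<in> S i" "y \<in> S i" "(?F ^^ p) x = (?F ^^ p) y"
      then have "u * \<phi> x = u * \<phi> y" using h(3)[OF xy(1)] h(3)[OF xy(2)] by argo
      then have "\<phi> x = \<phi> y" using u by simp
      then show "x = y" using inj_onD[OF inj] xy(1,2) by blast
    qed
    show "S i \<subseteq> (?F ^^ p) ` S i"
    proof
      fix w assume w: "w \<in> S i"
      have "\<phi> w \<in> round_annulus a b" using h(1) w unfolding homeomorphism_def by blast
      then have A: "\<phi> w / u \<in> round_annulus a b" using h(2) unfolding round_annulus_def by (simp add: norm_divide)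
      define z where "z = \<psi> (\<phi> w / u)"
      have z: "z \<in> S i" "\<phi> z = \<phi> w / u" unfolding z_def using h(1) A unfolding homeomorphism_def by auto
      then have "\<phi> ((?F ^^ p) z) = \<phi> w" using h(3) u by simp
      then have "(?F ^^ p) z = w" using inj_onD[OF inj] h(3)[OF z(1)] w by blast
      then show "w \<in> (?F ^^ p) ` S i" using z(1) by blast
    qed
  qed
  obtain p' where p': "p = Suc p'" using p gr0_conv_Suc by auto
  have inj: "inj_on ?F (S i)" for i
  proof (rule inj_onI)
    fix x y assume xy: "x \<in> S i" "y \<in> S i" "?F x = ?F y"
    then have "(?F ^^ p) x = (?F ^^ p) y" unfolding p' by (simp add: funpow_swap1)
    then show "x = y" using inj_onD[OF rot_inj] xy(1,2) by blast
  qed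
  (* A ring is mapped onto the next one because the return map of the latter is onto. *)
  have surj: "S (Suc i) \<subseteq> ?F ` S i" for i
  proof
    fix w assume "w \<in> S (Suc i)"
    then obtain y where y: "y \<in> S (Suc i)" "w = ?F ((?F ^^ p') y)" using rot_surj[of "Suc i"] unfolding p' by auto
    have "Suc i + p' = i + p" unfolding p' by simp
    then have "(?F ^^ p') y \<in> S i" using iter_S[OF y(1), of p'] per by metis
    then show "w \<in> ?F ` S i" using y(2) by blast
  qed
  have surj0: "S n \<subseteq> (?F ^^ n) ` S 0" for n
  proof (induction n)
    case (Suc n)
    have "S (Suc n) \<subseteq> ?F ` ((?F ^^ n) ` S 0)" using surj[of n] Suc by blast
    then show ?case by (simp add: image_comp)
  qed simp
  have iter_inj: "inj_on (?F ^^ n) (S 0)" and iter_cont: "continuous_on (S 0) (?F ^^ n)" for n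
  proof (induction n)
    case (Suc n)
    have im: "(?F ^^ n) ` S 0 \<subseteq> S n" using iter_S[of _ 0 n] by auto
    { case 1
      show ?case using comp_inj_on[OF Suc(1) inj_on_subset[OF inj im]] by (simp add: comp_def) }
    { case 2
      have "continuous_on (S n) ?F"
        by (rule continuous_on_subset[OF holomorphic_on_imp_continuous_on[OF tsq_holomorphic]]) (use np in blast)
      from continuous_on_compose[OF Suc(2) continuous_on_subset[OF this im]]
      show ?case by (simp add: comp_def) }
  qed (auto simp: id_def[symmetric])
  obtain a b \<phi> \<psi> u where h: "0 < a" "a < b" "homeomorphism (S 0) (round_annulus a b) \<phi> \<psi>" "norm u = 1"
    "\<And>z. z \<in> S 0 \<Longrightarrow> (?F ^^ p) z \<in> S 0 \<and> \<phi> ((?F ^^ p) z) = u * \<phi> z" using rot[of 0] by blast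
  have u: "u \<noteq> 0" using h(4) by auto
  have phi: "\<phi> z \<in> round_annulus a b" "\<psi> (\<phi> z) = z" if "z \<in> S 0" for z
    using h(3) that unfolding homeomorphism_def by auto
  have psi: "\<psi> w \<in> S 0" "\<phi> (\<psi> w) = w" if "w \<in> round_annulus a b" for w
    using h(3) that unfolding homeomorphism_def by auto
  have psi_cont: "continuous_on (round_annulus a b) \<psi>" and phi_cont: "continuous_on (S 0) \<phi>"
    using h(3) unfolding homeomorphism_def by auto
  define r where "r = (a + b) / 2"
  have r: "a < r" "r < b" "0 < r" unfolding r_def using h(1,2) by auto
  define G where "G i = (?F ^^ i) ` \<psi> ` sphere 0 r" for i
  have sph: "sphere 0 r \<subseteq> round_annulus a b" unfolding round_annulus_def using r by auto
  have G0: "G 0 = {z \<in> S 0. norm (\<phi> z) = r}"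
  proof
    show "G 0 \<subseteq> {z \<in> S 0. norm (\<phi> z) = r}" unfolding G_def using psi sph by auto
    show "{z \<in> S 0. norm (\<phi> z) = r} \<subseteq> G 0"
    proof
      fix z assume z: "z \<in> {z \<in> S 0. norm (\<phi> z) = r}"
      then have "\<phi> z \<in> sphere 0 r" "z = \<psi> (\<phi> z)" using phi(2) by auto
      then show "z \<in> G 0" unfolding G_def by auto
    qed
  qed
  have G_iter: "G i = (?F ^^ i) ` G 0" for i unfolding G_def by simp
  have G0S: "G 0 \<subseteq> S 0" unfolding G0 by blast
  have G_sub: "G i \<subseteq> S i" for i using iter_S[of _ 0 i] G0S unfolding G_iter[of i] by auto
  have inj_psi: "inj_on \<psi> (round_annulus a b)" by (rule inj_on_inverseI[of _ \<phi>]) (rule psi(2))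
  have J0: "jordan_curve (G 0)"
    unfolding G_def using jordan_curve_image[OF jordan_curve_sphere(1)[OF r(3)]]
      continuous_on_subset[OF psi_cont sph] inj_on_subset[OF inj_psi sph] by simp
  have J: "jordan_curve (G i)" for i
    unfolding G_iter[of i]
    using jordan_curve_image[OF J0 continuous_on_subset[OF iter_cont G0S] inj_on_subset[OF iter_inj G0S]] .
  have ret0: "(?F ^^ p) ` G 0 = G 0"
  proof
    show "(?F ^^ p) ` G 0 \<subseteq> G 0" unfolding G0 using h(4,5) by (auto simp: norm_mult)
    show "G 0 \<subseteq> (?F ^^ p) ` G 0"
    proof
      fix w assume w: "w \<in> G 0"
      then obtain z where z: "z \<in> S 0" "w = (?F ^^ p) z" using rot_surj[of 0] G0S by blast
      then have "norm (\<phi> z) = r" using w h(4,5) unfolding G0 by (auto simp: norm_mult)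
      then show "w \<in> (?F ^^ p) ` G 0" using z unfolding G0 by blast
    qed
  qed
  have G_per: "G (i + p) = G i" for i
  proof -
    have "G (i + p) = (?F ^^ i) ` ((?F ^^ p) ` G 0)" unfolding G_iter[of "i + p"] funpow_add image_comp ..
    then show ?thesis unfolding ret0 G_iter[of i] .
  qed
  have inside: "\<not> inside (G 0) \<subseteq> S 0"
  proof
    assume "inside (G 0) \<subseteq> S 0"
    then have sub: "filled (G 0) \<subseteq> S 0" using G0S unfolding filled_def by blast
    have "inj_on \<phi> (S 0)" by (rule inj_on_inverseI[of _ \<psi>]) (rule phi(2))
    then have "\<phi> ` inside (G 0) = inside (\<phi> ` G 0)"
      using image_inside_jordan[OF J0 continuous_on_subset[OF phi_cont sub]] inj_on_subset sub by blast
    moreover have "\<phi> ` G 0 = sphere 0 r"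
    proof -
      have "\<phi> ` \<psi> ` sphere 0 r = (\<lambda>w. w) ` sphere 0 r"
        unfolding image_image using psi(2) sph by (intro image_cong) auto
      then show ?thesis unfolding G_def by simp
    qed
    ultimately have "0 \<in> \<phi> ` inside (G 0)" using jordan_curve_sphere(2)[OF r(3)] r(3) by simp
    then obtain x where "x \<in> inside (G 0)" "\<phi> x = 0" by (metis imageE)
    moreover from this have "x \<in> S 0" using sub filled_props(4)[OF J0] by blast
    ultimately have "0 \<in> round_annulus a b" using phi(1) by metis
    then show False using h(1) unfolding round_annulus_def by simp
  qed
  have sides: "\<exists>C. connected C \<and> C \<subseteq> S i - G i \<and> z \<in> C \<and> (\<forall>t. (?F ^^ (p * t)) z \<in> C)"
    if z: "z \<in> S i - G i" for i z
  proof -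
    obtain y where y: "y \<in> S 0" "z = (?F ^^ i) y"
      using surj0[of i] z by (metis DiffD1 imageE subsetD)
    have yG: "y \<notin> G 0" using z y(2) unfolding G_iter[of i] by (metis DiffD2 imageI)
    (* The side of the invariant circle on which y lies is an invariant round annulus. *)
    obtain lo hi where lh: "lo < norm (\<phi> y)" "norm (\<phi> y) < hi" "a \<le> lo" "hi \<le> b" "r \<le> lo \<or> hi \<le> r"
    proof (cases "norm (\<phi> y) < r")
      case True
      then show ?thesis using that[of a r] phi(1)[OF y(1)] r unfolding round_annulus_def by simp
    next
      case False
      then have "r < norm (\<phi> y)" using yG y(1) unfolding G0 by simp
      then show ?thesis using that[of r b] phi(1)[OF y(1)] r unfolding round_annulus_def by simp
    qed
    define A where "A = {x \<in> S 0. lo < norm (\<phi> x) \<and> norm (\<phi> x) < hi}"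
    have sub: "round_annulus lo hi \<subseteq> round_annulus a b" unfolding round_annulus_def using lh by auto
    have A: "A = \<psi> ` round_annulus lo hi"
    proof
      show "A \<subseteq> \<psi> ` round_annulus lo hi"
      proof
        fix x assume "x \<in> A"
        then have "\<phi> x \<in> round_annulus lo hi" "x = \<psi> (\<phi> x)"
          using phi(2) unfolding A_def round_annulus_def by auto
        then show "x \<in> \<psi> ` round_annulus lo hi" by blast
      qed
      show "\<psi> ` round_annulus lo hi \<subseteq> A"
      proof
        fix x assume "x \<in> \<psi> ` round_annulus lo hi"
        then obtain w where "w \<in> round_annulus lo hi" "x = \<psi> w" by blast
        then show "x \<in> A" using psi[of w] sub unfolding A_def round_annulus_def by auto
      qed
    qed
    have AS: "A \<subseteq> S 0" unfolding A_def by blast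
    have "connected (round_annulus lo hi)"
      unfolding round_annulus_def using connected_annulus(1)[of lo "0::complex" hi] by simp
    then have conA: "connected A"
      unfolding A using connected_continuous_image continuous_on_subset[OF psi_cont sub] by blast
    have yA: "(?F ^^ (p * t)) y \<in> A" for t
    proof (induction t)
      case 0 then show ?case using y(1) lh unfolding A_def by simp
    next
      case (Suc t)
      have "(?F ^^ (p * Suc t)) y = (?F ^^ p) ((?F ^^ (p * t)) y)" by (simp add: funpow_add)
      then show ?case using Suc h(4,5) unfolding A_def by (auto simp: norm_mult)
    qed
    have AG: "A \<inter> G 0 = {}" unfolding A_def G0 using lh(5) by auto
    let ?C = "(?F ^^ i) ` A"
    have "connected ?C" using connected_continuous_image[OF continuous_on_subset[OF iter_cont AS] conA] .
    moreover have "?C \<subseteq> S i" using iter_S[of _ 0 i] AS by auto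
    moreover have "?C \<inter> G i = {}"
      unfolding G_iter[of i] using inj_on_image_Int[OF iter_inj[of i] AS G0S] AG by simp
    moreover have "(?F ^^ (p * t)) z \<in> ?C" for t
    proof -
      have "(?F ^^ (p * t)) z = (?F ^^ i) ((?F ^^ (p * t)) y)"
        unfolding y(2) by (metis add.commute comp_apply funpow_add)
      then show ?thesis using yA by blast
    qed
    moreover have "z \<in> ?C" using yA[of 0] y(2) by simp
    ultimately show ?thesis by blast
  qed
  have S_np: "S i \<inter> tsq_poles = {}" for i using np by blast
  have max: "U \<subseteq> S i" if U: "open U" "connected U" "U \<inter> S i \<noteq> {}"
    "\<And>n z. z \<in> U \<Longrightarrow> (?F ^^ n) z \<notin> tsq_poles" "bounded (\<Union>n. (?F ^^ n) ` U)" for U i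
    using components_maximal[OF comp U(2) bounded_orbits_fatou[OF U(1,4,5)]] U(3) by blast
  have G_step: "?F ` G i = G (Suc i)" for i unfolding G_def by (simp add: image_comp)
  note filled_inj = tsq_inj_filled[OF S_open S_np inj J G_sub]
  have "curve_cycle ?F tsq_poles (c + \<i>) p S G"
    by (unfold_locales; fact p tsq_holomorphic tsq_at_pole tsq_omits S_open disj
        S_np step inj max sides J G_sub G_step G_per inside filled_inj)
  then show ?thesis by blast
qed

theorem theorem3p1:
  fixes c :: complex
  shows "\<not> (\<exists>U. herman_ring (tan_square_map c) U)"
proof
  assume "\<exists>U. herman_ring (tan_square_map c) U"
  then obtain p S0 where "herman_ring_cycle (tan_square_map c) p S0" unfolding herman_ring_def by blast
  then obtain S G where "curve_cycle (tsq c) tsq_poles (c + \<i>) p S G"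
    using herman_ring_cycle_curves by blast
  then show False by (rule curve_cycle.curve_cycle_impossible)
qed

end
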